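(* Let $c_1,c_2,\phi$ be real with $c_1\ne c_2$, $c_2\neq 0$ and $2(c_1+c_2-3c_1c_2)-1=0$. Then the 2-stage modified two-derivative diagonally implicit Runge--Kutta method with nodes $c_1,c_2$ and coefficients $$a_{11}(\mu)=\frac{1}{\mu^2}\left(1-\frac{2}{E_\mu^{+}(c_1)}\right),\quad a_{21}(\mu)=\phi,\quad a_{22}(\mu)=\frac{E_\mu^{+}(c_2)-\left(2+\phi\mu^2E_\mu^{+}(c_1)\right)}{\mu^2E_\mu^{+}(c_2)},$$ $$\xi_1(\mu)=\frac{E_\mu^{-}(c_1)}{c_1\mu E_\mu^{+}(c_1)},\quad \xi_2(\mu)=\frac{E_\mu^{-}(c_2)-\phi\mu^2E_\mu^{-}(c_1-c_2)}{c_2\mu E_\mu^{+}(c_2)},$$ $$b_1(\mu)=\frac{E_\mu^{-}(c_2)+E_\mu^{-}(1-c_2)-\mu E_\mu^{+}(c_2)}{\mu^2E_\mu^{-}(c_1-c_2)},\quad b_2(\mu)=\frac{\mu E_\mu^{+}(c_1)-E_\mu^{-}(c_1)-E_\mu^{-}(1-c_1)}{\mu^2E_\mu^{-}(c_1-c_2)}$$ is exponentially fitted (it satisfies the fitting conditions for $e^{\pm\mathrm{i}\omega x}$) and has order of consistency four.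
   Context: A 2-stage modified two-derivative diagonally implicit Runge--Kutta (TDDIRK) method for $y'=f(y)$, with $g(y)=f'(y)f(y)$, stepsize $h$, frequency $\omega>0$ and $\mu=\mathrm{i}\omega h$, is $$Y_i = y_n+\xi_i(\mu)c_{i} h f(y_n)+h^2\sum_{j=1}^{i} a_{ij}(\mu)g(Y_j),\ i=1,2,\qquad y_{n+1} = y_n+h f(y_n)+h^2\sum_{i=1}^2 b_i(\mu)g(Y_i).$$ $E_\mu^{+}(\zeta)=e^{\zeta\mu}+e^{-\zeta\mu}$, $E_\mu^{-}(\zeta)=e^{\zeta\mu}-e^{-\zeta\mu}$ for $\zeta\in\mathbb{R}$. Removable singularities (at $\mu=0$, and in $\xi_1$ when $c_1=0$) are filled by limits, so $\xi_1=1$ if $c_1=0$; $h$ is small enough that the denominators do not vanish. Fitting conditions for $e^{\pm\mathrm{i}\omega x}$ (degree $(0,1)$), for both choices of sign: $$\mu^2\sum_{j=1}^{i}a_{ij}(\mu)e^{\pm c_j\mu}\pm\xi_i(\mu)c_i\mu=e^{\pm c_i\mu}-1\ (i=1,2),\qquad \mu^2\sum_{i=1}^{2}b_i(\mu)e^{\pm c_i\mu}=e^{\pm\mu}-1\mp\mu.$$ Order of consistency $p$: for $f$ sufficiently smooth and $y(x_n)=y_n$, $y(x_n+h)-y_{n+1}=\mathcal{O}(h^{p+1})$ as $h\to0$ (with $\omega$ fixed). *)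

theory Defs
  imports "HOL-Analysis.Analysis" "HOL-Library.Landau_Symbols"
    "HOL-Complex_Analysis.Complex_Analysis"
begin

section \<open>Two-stage modified two-derivative DIRK methods\<close>

text \<open>The stages are indexed by 1 and 2. The coefficients are functions of
  \<open>\<mu> = \<i> \<omega> h\<close>; only the entries \<open>acoef i j\<close> with \<open>j \<le> i\<close> are used.\<close>

record tddirk =
  cnode :: "nat \<Rightarrow> real"
  acoef :: "nat \<Rightarrow> nat \<Rightarrow> complex \<Rightarrow> complex"
  xicoef :: "nat \<Rightarrow> complex \<Rightarrow> complex"
  bcoef :: "nat \<Rightarrow> complex \<Rightarrow> complex"

definition mu :: "real \<Rightarrow> real \<Rightarrow> complex" where
  "mu \<omega> h = \<i> * complex_of_real (\<omega> * h)"

definition second_deriv_field :: "('a::euclidean_space \<Rightarrow> 'a) \<Rightarrow> 'a \<Rightarrow> 'a" where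
  "second_deriv_field f y = frechet_derivative f (at y) (f y)"

text \<open>The state space is real, so the coefficients enter through their real parts. For the
  method below all coefficients are real on the imaginary axis
  (lemma \<open>ef_tddirk_coeffs_real\<close>), so that nothing is discarded.\<close>

definition stage_equations ::
  "tddirk \<Rightarrow> real \<Rightarrow> ('a::euclidean_space \<Rightarrow> 'a) \<Rightarrow> 'a \<Rightarrow> real \<Rightarrow> (nat \<Rightarrow> 'a) \<Rightarrow> bool" where
  "stage_equations M \<omega> f yn h Y \<longleftrightarrow>
     (\<forall>i\<in>{1..2}. Y i = yn + (Re (xicoef M i (mu \<omega> h)) * cnode M i * h) *\<^sub>R f yn
        + h^2 *\<^sub>R (\<Sum>j=1..i. Re (acoef M i j (mu \<omega> h)) *\<^sub>R second_deriv_field f (Y j)))"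

definition tddirk_step ::
  "tddirk \<Rightarrow> real \<Rightarrow> ('a::euclidean_space \<Rightarrow> 'a) \<Rightarrow> 'a \<Rightarrow> real \<Rightarrow> (nat \<Rightarrow> 'a) \<Rightarrow> 'a" where
  "tddirk_step M \<omega> f yn h Y =
     yn + h *\<^sub>R f yn
        + h^2 *\<^sub>R (\<Sum>i=1..2. Re (bcoef M i (mu \<omega> h)) *\<^sub>R second_deriv_field f (Y i))"

section \<open>Order of consistency\<close>

text \<open>\<open>C_on k f U\<close>: \<open>f\<close> is \<open>k\<close> times continuously differentiable on the open set \<open>U\<close>.
  Since the domain is finite-dimensional, this can be expressed by directional derivatives.\<close>

fun C_on :: "nat \<Rightarrow> ('a::euclidean_space \<Rightarrow> 'b::euclidean_space) \<Rightarrow> 'a set \<Rightarrow> bool" where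
  "C_on 0 f U \<longleftrightarrow> continuous_on U f"
| "C_on (Suc k) f U \<longleftrightarrow>
     (\<forall>x\<in>U. f differentiable at x) \<and> (\<forall>v. C_on k (\<lambda>x. frechet_derivative f (at x) v) U)"

definition local_solution ::
  "('a::euclidean_space \<Rightarrow> 'a) \<Rightarrow> 'a set \<Rightarrow> (real \<Rightarrow> 'a) \<Rightarrow> real \<Rightarrow> bool" where
  "local_solution f U y x0 \<longleftrightarrow>
     (\<exists>T>0. \<forall>t. \<bar>t - x0\<bar> < T \<longrightarrow> y t \<in> U \<and> (y has_vector_derivative f (y t)) (at t))"

text \<open>The stage equations are implicit and may have spurious solutions that run off to infinity
  as \<open>h \<rightarrow> 0\<close>; the numerical solution is the one whose stages stay in a fixed ball around
  \<open>y x0\<close>. These stages are required to exist and to be unique for small \<open>h\<close>; uniqueness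
  makes sense because \<open>\<rightarrow>\<^sub>E\<close> fixes the value of \<open>Y\<close> outside the index set.\<close>

definition consistency_order ::
  "'a::euclidean_space itself \<Rightarrow> tddirk \<Rightarrow> real \<Rightarrow> nat \<Rightarrow> bool" where
  "consistency_order _ M \<omega> p \<longleftrightarrow>
     (\<forall>(f :: 'a \<Rightarrow> 'a) U y x0. open U \<and> C_on p f U \<and> local_solution f U y x0 \<longrightarrow>
       (\<exists>r>0. ball (y x0) r \<subseteq> U
         \<and> (\<forall>\<^sub>F h in at 0. \<exists>!Y. Y \<in> {1..2} \<rightarrow>\<^sub>E ball (y x0) r \<and> stage_equations M \<omega> f (y x0) h Y)
         \<and> (\<forall>Y. (\<forall>\<^sub>F h in at 0. Y h \<in> {1..2} \<rightarrow>\<^sub>E ball (y x0) r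
                                  \<and> stage_equations M \<omega> f (y x0) h (Y h)) \<longrightarrow>
              (\<lambda>h. norm (y (x0 + h) - tddirk_step M \<omega> f (y x0) h (Y h)))
                \<in> O[at 0](\<lambda>h. h ^ (p + 1)))))"

section \<open>Exponential fitting\<close>

definition fitting_conditions :: "tddirk \<Rightarrow> complex \<Rightarrow> bool" where
  "fitting_conditions M \<mu> \<longleftrightarrow>
     (\<forall>s\<in>{1, -1 :: complex}.
        (\<forall>i\<in>{1..2}.
           \<mu>^2 * (\<Sum>j=1..i. acoef M i j \<mu> * exp (s * cnode M j * \<mu>))
             + s * xicoef M i \<mu> * cnode M i * \<mu> = exp (s * cnode M i * \<mu>) - 1)
      \<and> \<mu>^2 * (\<Sum>i=1..2. bcoef M i \<mu> * exp (s * cnode M i * \<mu>)) = exp (s * \<mu>) - 1 - s * \<mu>)"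

section \<open>The exponentially fitted method\<close>

definition Eplus :: "real \<Rightarrow> complex \<Rightarrow> complex" where
  "Eplus \<zeta> \<mu> = exp (\<zeta> * \<mu>) + exp (- \<zeta> * \<mu>)"

definition Eminus :: "real \<Rightarrow> complex \<Rightarrow> complex" where
  "Eminus \<zeta> \<mu> = exp (\<zeta> * \<mu>) - exp (- \<zeta> * \<mu>)"

text \<open>\<open>remove_sings\<close> fills the removable singularities in \<open>\<mu>\<close>, in particular at \<open>\<mu> = 0\<close>.
  The case \<open>c1 = 0\<close> in \<open>ef_xi1\<close> is the limit of the quotient as \<open>c1 \<rightarrow> 0\<close>.\<close>

definition ef_a11 :: "real \<Rightarrow> complex \<Rightarrow> complex" where
  "ef_a11 c1 = remove_sings (\<lambda>\<mu>. 1 / \<mu>^2 * (1 - 2 / Eplus c1 \<mu>))"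

definition ef_a22 :: "real \<Rightarrow> real \<Rightarrow> real \<Rightarrow> complex \<Rightarrow> complex" where
  "ef_a22 c1 c2 \<phi> = remove_sings (\<lambda>\<mu>.
     (Eplus c2 \<mu> - (2 + \<phi> * \<mu>^2 * Eplus c1 \<mu>)) / (\<mu>^2 * Eplus c2 \<mu>))"

definition ef_xi1 :: "real \<Rightarrow> complex \<Rightarrow> complex" where
  "ef_xi1 c1 = (if c1 = 0 then (\<lambda>_. 1)
     else remove_sings (\<lambda>\<mu>. Eminus c1 \<mu> / (c1 * \<mu> * Eplus c1 \<mu>)))"

definition ef_xi2 :: "real \<Rightarrow> real \<Rightarrow> real \<Rightarrow> complex \<Rightarrow> complex" where
  "ef_xi2 c1 c2 \<phi> = remove_sings (\<lambda>\<mu>.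
     (Eminus c2 \<mu> - \<phi> * \<mu>^2 * Eminus (c1 - c2) \<mu>) / (c2 * \<mu> * Eplus c2 \<mu>))"

definition ef_b1 :: "real \<Rightarrow> real \<Rightarrow> complex \<Rightarrow> complex" where
  "ef_b1 c1 c2 = remove_sings (\<lambda>\<mu>.
     (Eminus c2 \<mu> + Eminus (1 - c2) \<mu> - \<mu> * Eplus c2 \<mu>) / (\<mu>^2 * Eminus (c1 - c2) \<mu>))"

definition ef_b2 :: "real \<Rightarrow> real \<Rightarrow> complex \<Rightarrow> complex" where
  "ef_b2 c1 c2 = remove_sings (\<lambda>\<mu>.
     (\<mu> * Eplus c1 \<mu> - Eminus c1 \<mu> - Eminus (1 - c1) \<mu>) / (\<mu>^2 * Eminus (c1 - c2) \<mu>))"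

definition ef_tddirk :: "real \<Rightarrow> real \<Rightarrow> real \<Rightarrow> tddirk" where
  "ef_tddirk c1 c2 \<phi> =
     \<lparr> cnode = (\<lambda>i. if i = 1 then c1 else c2),
       acoef = (\<lambda>i j. if i = 1 then ef_a11 c1
                      else if j = 1 then (\<lambda>_. complex_of_real \<phi>) else ef_a22 c1 c2 \<phi>),
       xicoef = (\<lambda>i. if i = 1 then ef_xi1 c1 else ef_xi2 c1 c2 \<phi>),
       bcoef = (\<lambda>i. if i = 1 then ef_b1 c1 c2 else ef_b2 c1 c2) \<rparr>"

text \<open>The denominators do not vanish, apart from the removable singularity at \<open>\<mu> = 0\<close>.\<close>

definition ef_admissible :: "real \<Rightarrow> real \<Rightarrow> complex \<Rightarrow> bool" where
  "ef_admissible c1 c2 \<mu> \<longleftrightarrow>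
     \<mu> = 0 \<or> (Eplus c1 \<mu> \<noteq> 0 \<and> Eplus c2 \<mu> \<noteq> 0 \<and> Eminus (c1 - c2) \<mu> \<noteq> 0)"

subsection \<open>Sanity checks\<close>

lemma Im_remove_sings_imaginary_axis:
  assumes sym: "\<And>z. F (- cnj z) = cnj (F z)"
  shows "Im (remove_sings F (mu \<omega> h)) = 0"
proof (cases "\<exists>c. F \<midarrow>mu \<omega> h\<rightarrow> c")
  case True
  then obtain c where c: "F \<midarrow>mu \<omega> h\<rightarrow> c" by blast
  have fixpoint: "- cnj (mu \<omega> h) = mu \<omega> h"
    by (simp add: mu_def)
  have "(\<lambda>z. - cnj z) \<midarrow>mu \<omega> h\<rightarrow> - cnj (mu \<omega> h)"
    by (intro tendsto_intros)
  then have "filterlim (\<lambda>z. - cnj z) (at (mu \<omega> h)) (at (mu \<omega> h))"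
    unfolding fixpoint
    by (rule filterlim_atI) (use fixpoint in \<open>auto simp: eventually_at_filter
          intro!: always_eventually, metis complex_cnj_cnj complex_cnj_minus minus_minus\<close>)
  from filterlim_compose[OF c this] have "(\<lambda>z. cnj (F z)) \<midarrow>mu \<omega> h\<rightarrow> c"
    by (simp add: sym)
  moreover have "(\<lambda>z. cnj (F z)) \<midarrow>mu \<omega> h\<rightarrow> cnj c"
    using c by (intro tendsto_intros)
  ultimately have "c = cnj c"
    using tendsto_unique by (metis at_neq_bot)
  then have "Im c = 0"
    by (metis Reals_cnj_iff complex_is_Real_iff)
  with remove_sings_eqI[OF c] show ?thesis by simp
qed (simp add: remove_sings_def)

lemma Eplus_reflect: "Eplus \<zeta> (- cnj z) = cnj (Eplus \<zeta> z)"
  by (simp add: Eplus_def exp_cnj)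

lemma Eminus_reflect: "Eminus \<zeta> (- cnj z) = - cnj (Eminus \<zeta> z)"
  by (simp add: Eminus_def exp_cnj)

lemma ef_tddirk_coeffs_real:
  "Im (acoef (ef_tddirk c1 c2 \<phi>) i j (mu \<omega> h)) = 0"
  "Im (xicoef (ef_tddirk c1 c2 \<phi>) i (mu \<omega> h)) = 0"
  "Im (bcoef (ef_tddirk c1 c2 \<phi>) i (mu \<omega> h)) = 0"
proof -
  have "Im (ef_a11 c1 (mu \<omega> h)) = 0" "Im (ef_a22 c1 c2 \<phi> (mu \<omega> h)) = 0"
    "Im (ef_xi1 c1 (mu \<omega> h)) = 0" "Im (ef_xi2 c1 c2 \<phi> (mu \<omega> h)) = 0"
    "Im (ef_b1 c1 c2 (mu \<omega> h)) = 0" "Im (ef_b2 c1 c2 (mu \<omega> h)) = 0"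
    unfolding ef_a11_def ef_a22_def ef_xi1_def ef_xi2_def ef_b1_def ef_b2_def
    by (auto intro!: Im_remove_sings_imaginary_axis
        simp: Eplus_reflect Eminus_reflect divide_simps)
  then show "Im (acoef (ef_tddirk c1 c2 \<phi>) i j (mu \<omega> h)) = 0"
    "Im (xicoef (ef_tddirk c1 c2 \<phi>) i (mu \<omega> h)) = 0"
    "Im (bcoef (ef_tddirk c1 c2 \<phi>) i (mu \<omega> h)) = 0"
    by (simp_all add: ef_tddirk_def)
qed

lemma Eplus_mu: "Eplus \<zeta> (mu \<omega> h) = 2 * complex_of_real (cos (\<zeta> * \<omega> * h))"
  by (simp add: Eplus_def mu_def complex_eq_iff Re_exp Im_exp mult.assoc)

lemma Eminus_mu: "Eminus \<zeta> (mu \<omega> h) = 2 * \<i> * complex_of_real (sin (\<zeta> * \<omega> * h))"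
  by (simp add: Eminus_def mu_def complex_eq_iff Re_exp Im_exp mult.assoc)

lemma ef_admissible_small:
  assumes "c1 \<noteq> c2"
  shows "\<forall>\<^sub>F h in nhds 0. ef_admissible c1 c2 (mu \<omega> h)"
proof -
  have small: "\<forall>\<^sub>F h in nhds 0. \<bar>\<zeta> * \<omega> * h\<bar> < 1" for \<zeta> :: real
  proof -
    have "((\<lambda>h. \<bar>\<zeta> * \<omega> * h\<bar>) \<longlongrightarrow> \<bar>\<zeta> * \<omega> * 0\<bar>) (nhds 0)"
      by (intro tendsto_intros filterlim_ident)
    then show ?thesis by (rule order_tendstoD(2)) simp
  qed
  show ?thesis
    using small[of c1] small[of c2] small[of "c1 - c2"]
  proof eventually_elim
    case (elim h)
    have cos_pos: "cos x > 0" if "\<bar>x\<bar> < 1" for x :: real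
      using that pi_gt3 by (intro cos_gt_zero_pi) auto
    have sin_nz: "sin x \<noteq> 0" if "\<bar>x\<bar> < 1" "x \<noteq> 0" for x :: real
      using that pi_gt3 sin_gt_zero[of x] sin_gt_zero[of "- x"] by (cases "x > 0") auto
    show ?case
    proof (cases "\<omega> * h = 0")
      case True
      then show ?thesis by (simp add: ef_admissible_def mu_def)
    next
      case False
      then have "(c1 - c2) * \<omega> * h \<noteq> 0" using assms by simp
      then show ?thesis
        using cos_pos[OF elim(1)] cos_pos[OF elim(2)] sin_nz[OF elim(3)]
        by (simp add: ef_admissible_def Eplus_mu Eminus_mu)
    qed
  qed
qed

end

theory Submission
  imports Defs
begin

text \<open>Adding and subtracting the two fitting conditions for \<open>\<plusminus>\<i>\<omega>\<close> turns them into real equations with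
  \<open>cos\<close> and \<open>sin\<close>, and these alone determine the coefficients to the accuracy needed:
  \<open>\<Sum>\<^sub>j a\<^sub>i\<^sub>j = c\<^sub>i\<^sup>2 / 2 + O(h\<^sup>2)\<close>, \<open>\<xi>\<^sub>i c\<^sub>i = c\<^sub>i + O(h\<^sup>2)\<close>, \<open>\<Sum> b\<^sub>i = 1/2 + O(h\<^sup>2)\<close> and
  \<open>\<Sum> b\<^sub>i c\<^sub>i = 1/6 + O(h\<^sup>2)\<close>. The condition on the nodes is the remaining quadrature condition
  \<open>\<Sum> b\<^sub>i c\<^sub>i\<^sup>2 = 1/12\<close> at \<open>h = 0\<close>, and feeding it back into the \<open>cos\<close> equation improves the first
  sum to \<open>\<Sum> b\<^sub>i = 1/2 + O(h\<^sup>4)\<close>. The stages then agree with the solution at the nodes up to \<open>O(h\<^sup>3)\<close>, and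
  Taylor expansion, with the derivatives of the solution written as iterated Lie derivatives of
  \<open>f\<close> along itself, gives the order. The stages exist and are unique in a ball by Banach's fixed
  point theorem.\<close>

section \<open>Order of vanishing at 0\<close>

text \<open>The relation \<open>F = O(h^k)\<close> for vector-valued \<open>F\<close>; taking the
  norm brings it into the scope of Landau symbols for scalar functions. The filter is punctured, so
  \<open>F 0\<close> is ignored, and \<open>k = 0\<close> means that \<open>F\<close> is bounded
  near 0.\<close>

definition vanishes_to :: "nat \<Rightarrow> (real \<Rightarrow> 'a::real_normed_vector) \<Rightarrow> bool" where
  "vanishes_to k F \<longleftrightarrow> (\<lambda>h. norm (F h)) \<in> O[at 0](\<lambda>h. h ^ k)"

lemma vanishes_toI:
  assumes "\<forall>\<^sub>F h in at 0. norm (F h) \<le> C * \<bar>h\<bar> ^ k"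
  shows "vanishes_to k F"
  unfolding vanishes_to_def
  by (rule bigoI[of _ C]) (use assms in \<open>simp add: power_abs\<close>)

lemma vanishes_toE:
  assumes "vanishes_to k F"
  obtains C where "C > 0" "\<forall>\<^sub>F h in at 0. norm (F h) \<le> C * \<bar>h\<bar> ^ k"
  using assms unfolding vanishes_to_def by (elim landau_o.bigE) (simp add: power_abs)

lemma vanishes_to_cong:
  assumes "\<forall>\<^sub>F h in at 0. F h = G h" "vanishes_to k G"
  shows "vanishes_to k F"
proof -
  have "\<forall>\<^sub>F h in at 0. norm (F h) = norm (G h)"
    using assms(1) by eventually_elim simp
  from landau_o.big.in_cong[OF this] assms(2) show ?thesis by (simp add: vanishes_to_def)
qed

lemma vanishes_to_add:
  assumes "vanishes_to k F" "vanishes_to k G"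
  shows "vanishes_to k (\<lambda>h. F h + G h)"
proof -
  obtain C where C: "\<forall>\<^sub>F h in at 0. norm (F h) \<le> C * \<bar>h\<bar> ^ k" using assms(1) by (rule vanishes_toE)
  obtain D where D: "\<forall>\<^sub>F h in at 0. norm (G h) \<le> D * \<bar>h\<bar> ^ k" using assms(2) by (rule vanishes_toE)
  show ?thesis
  proof (rule vanishes_toI[of _ "C + D"], use C D in eventually_elim)
    case (elim h)
    then show ?case using norm_triangle_ineq[of "F h" "G h"] by (simp add: distrib_right)
  qed
qed

lemma vanishes_to_minus: "vanishes_to k F \<Longrightarrow> vanishes_to k (\<lambda>h. - F h)"
  by (simp add: vanishes_to_def)

lemma vanishes_to_diff:
  assumes "vanishes_to k F" "vanishes_to k G"
  shows "vanishes_to k (\<lambda>h. F h - G h)"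
  using vanishes_to_add[OF assms(1) vanishes_to_minus[OF assms(2)]] by simp

lemma vanishes_to_scaleR:
  assumes "vanishes_to j a" "vanishes_to k F"
  shows "vanishes_to (j + k) (\<lambda>h. a h *\<^sub>R F h)"
  using landau_o.big.mult[OF assms[unfolded vanishes_to_def]]
  by (simp add: vanishes_to_def power_add)

lemma vanishes_to_mult:
  fixes a F :: "real \<Rightarrow> real"
  assumes "vanishes_to j a" "vanishes_to k F"
  shows "vanishes_to (j + k) (\<lambda>h. a h * F h)"
  using vanishes_to_scaleR[OF assms] by simp

lemma vanishes_to_bounded_scaleR:
  "vanishes_to 0 a \<Longrightarrow> vanishes_to k F \<Longrightarrow> vanishes_to k (\<lambda>h. a h *\<^sub>R F h)"
  by (drule (1) vanishes_to_scaleR) (simp only: add_0)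

lemma vanishes_to_bounded_mult:
  fixes a F :: "real \<Rightarrow> real"
  shows "vanishes_to 0 a \<Longrightarrow> vanishes_to k F \<Longrightarrow> vanishes_to k (\<lambda>h. a h * F h)"
  by (drule (1) vanishes_to_mult) (simp only: add_0)

lemma vanishes_to_power: "vanishes_to k (\<lambda>h. h ^ k)"
  by (simp add: vanishes_to_def)

lemma vanishes_to_mono:
  assumes "vanishes_to k F" "j \<le> k"
  shows "vanishes_to j F"
proof -
  obtain C where "C > 0" and C: "\<forall>\<^sub>F h in at 0. norm (F h) \<le> C * \<bar>h\<bar> ^ k" using assms(1) by (rule vanishes_toE)
  have "\<forall>\<^sub>F h::real in at 0. \<bar>h\<bar> < 1"
    by (intro eventually_at_in_open'[of "{-1<..<1}" , THEN eventually_mono]) auto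
  with C have "\<forall>\<^sub>F h in at 0. norm (F h) \<le> C * \<bar>h\<bar> ^ j"
  proof eventually_elim
    case (elim h)
    have "\<bar>h\<bar> ^ k \<le> \<bar>h\<bar> ^ j" using elim assms(2) by (intro power_decreasing) auto
    then show ?case using elim(1) \<open>C > 0\<close> by (meson mult_left_mono less_imp_le order_trans)
  qed
  then show ?thesis by (rule vanishes_toI)
qed

lemma vanishes_to_tendsto:
  assumes "(F \<longlongrightarrow> l) (at 0)"
  shows "vanishes_to 0 F"
proof -
  have "\<forall>\<^sub>F h in at 0. norm (F h) < norm l + 1"
    using assms by (intro order_tendstoD(2)[where y = "norm l"] tendsto_norm) auto
  then show ?thesis by (intro vanishes_toI[of _ "norm l + 1"]) (auto elim: eventually_mono)
qed

lemma vanishes_to_const: "vanishes_to 0 (\<lambda>_. c)"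
  by (rule vanishes_to_tendsto) auto

lemma vanishes_to_cmult:
  fixes F :: "real \<Rightarrow> real"
  shows "vanishes_to k F \<Longrightarrow> vanishes_to k (\<lambda>h. c * F h)"
  by (rule vanishes_to_bounded_mult[OF vanishes_to_const])

text \<open>Division by \<open>h ^ j\<close> is legitimate because the punctured filter excludes
  \<open>h = 0\<close>. The exponent relation is a separate premise so that numerals can be put in
  directly.\<close>

lemma vanishes_to_cancel:
  assumes "vanishes_to k (\<lambda>h. h ^ j *\<^sub>R F h)" "k = j + m"
  shows "vanishes_to m F"
proof -
  obtain C where C: "\<forall>\<^sub>F h in at 0. norm (h ^ j *\<^sub>R F h) \<le> C * \<bar>h\<bar> ^ k" using assms(1) by (rule vanishes_toE)
  have "\<forall>\<^sub>F h::real in at 0. h \<noteq> 0" by (simp add: eventually_at_filter)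
  with C have "\<forall>\<^sub>F h in at 0. norm (F h) \<le> C * \<bar>h\<bar> ^ m"
    by eventually_elim (simp add: assms(2) power_add power_abs mult_ac)
  then show ?thesis by (rule vanishes_toI)
qed

text \<open>A factor with nonzero limit has a locally bounded inverse, and multiplying by a bounded
  function preserves the rate.\<close>

lemma vanishes_to_cancel_limit:
  fixes a d :: "real \<Rightarrow> real"
  assumes "vanishes_to k (\<lambda>h. a h * d h)" "(d \<longlongrightarrow> l) (at 0)" "l \<noteq> 0"
  shows "vanishes_to k a"
proof (rule vanishes_to_cong)
  have "((\<lambda>h. inverse (d h)) \<longlongrightarrow> inverse l) (at 0)"
    using assms(2,3) by (intro tendsto_intros)
  then have "vanishes_to (k + 0) (\<lambda>h. a h * d h * inverse (d h))"
    by (intro vanishes_to_mult assms(1) vanishes_to_tendsto)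
  then show "vanishes_to k (\<lambda>h. a h * d h * inverse (d h))" by simp
  have "\<forall>\<^sub>F h in at 0. d h \<noteq> 0" using assms(2,3) by (rule tendsto_imp_eventually_ne)
  then show "\<forall>\<^sub>F h in at 0. a h = a h * d h * inverse (d h)" by eventually_elim simp
qed

lemma vanishes_to_imp_tendsto:
  assumes "vanishes_to k F" "k > 0"
  shows "(F \<longlongrightarrow> 0) (at 0)"
proof -
  obtain C where C: "\<forall>\<^sub>F h in at 0. norm (F h) \<le> C * \<bar>h\<bar> ^ k" using assms(1) by (rule vanishes_toE)
  have "((\<lambda>h. C * \<bar>h\<bar> ^ k) \<longlongrightarrow> C * \<bar>0\<bar> ^ k) (at (0::real))" by (intro tendsto_intros)
  with C show ?thesis using assms(2) by (intro Lim_null_comparison[OF C]) (simp add: power_0_left)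
qed

lemma vanishes_to_lipschitz:
  assumes "vanishes_to k (\<lambda>h. u h - v h)"
    and "\<forall>\<^sub>F h in at 0. norm (g (u h) - g (v h)) \<le> L * norm (u h - v h)"
  shows "vanishes_to k (\<lambda>h. g (u h) - g (v h))"
proof -
  obtain C where "C > 0" and C: "\<forall>\<^sub>F h in at 0. norm (u h - v h) \<le> C * \<bar>h\<bar> ^ k"
    using assms(1) by (rule vanishes_toE)
  from C assms(2) have "\<forall>\<^sub>F h in at 0. norm (g (u h) - g (v h)) \<le> (\<bar>L\<bar> * C) * \<bar>h\<bar> ^ k"
  proof eventually_elim
    case (elim h)
    have "L * norm (u h - v h) \<le> \<bar>L\<bar> * (C * \<bar>h\<bar> ^ k)"
      using elim(1) by (intro mult_mono) auto
    with elim(2) show ?case by (simp add: mult.assoc)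
  qed
  then show ?thesis by (rule vanishes_toI)
qed

section \<open>Integration of remainders and Taylor expansion\<close>

text \<open>The mean value inequality on the segment from 0 to \<open>h\<close> gains one factor
  \<open>|h|\<close>. The derivative exists on a full neighbourhood of 0, but its bound is known
  only for nonzero arguments.\<close>

lemma vanishes_to_antiderivative:
  fixes F :: "real \<Rightarrow> 'a::real_inner"
  assumes der: "\<forall>\<^sub>F h in nhds 0. (F has_vector_derivative F' h) (at h)"
    and "F 0 = 0" "vanishes_to k F'"
  shows "vanishes_to (Suc k) F"
proof -
  obtain C where "C > 0" and C: "\<forall>\<^sub>F h in at 0. norm (F' h) \<le> C * \<bar>h\<bar> ^ k"
    using assms(3) by (rule vanishes_toE)
  have "\<forall>\<^sub>F h in nhds 0. (F has_vector_derivative F' h) (at h) \<and> (h \<noteq> 0 \<longrightarrow> norm (F' h) \<le> C * \<bar>h\<bar> ^ k)"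
    using der C unfolding eventually_at_filter by eventually_elim simp
  then obtain d where "d > 0" and d: "\<And>h. \<bar>h\<bar> < d \<Longrightarrow> (F has_vector_derivative F' h) (at h)"
    "\<And>h. \<bar>h\<bar> < d \<Longrightarrow> h \<noteq> 0 \<Longrightarrow> norm (F' h) \<le> C * \<bar>h\<bar> ^ k"
    unfolding eventually_nhds_metric by (auto simp: dist_real_def)
  have bound: "norm (F h) \<le> C * \<bar>h\<bar> ^ Suc k" if "h \<noteq> 0" "\<bar>h\<bar> < d" for h
  proof -
    \<comment> \<open>The sign reflects a negative \<open>h\<close>, so that the mean value theorem
      on \<open>{0..|h|}\<close> serves both sides of 0. The intermediate point lies in the open
      interval, hence \<open>s * t\<close> is nonzero and the bound on \<open>F'\<close> applies
      there.\<close>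
    define s where "s = sgn h"
    have s: "s * \<bar>h\<bar> = h" "\<bar>s\<bar> = 1" using that by (auto simp: s_def sgn_mult_abs)
    have small: "\<bar>s * t\<bar> < d" if "t \<in> {0..\<bar>h\<bar>}" for t
      using that s \<open>\<bar>h\<bar> < d\<close> by (auto simp: abs_mult)
    have D: "((\<lambda>t. F (s * t)) has_vector_derivative s *\<^sub>R F' (s * t)) (at t)"
      if "t \<in> {0..\<bar>h\<bar>}" for t
    proof -
      have "((\<lambda>t. s * t) has_vector_derivative s) (at t)"
        by (auto intro!: derivative_eq_intros simp: has_real_derivative_iff_has_vector_derivative[symmetric])
      from vector_diff_chain_at[OF this d(1)[OF small[OF that]]] show ?thesis
        by (simp add: o_def)
    qed
    have "continuous_on {0..\<bar>h\<bar>} (\<lambda>t. F (s * t))"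
      using D by (intro continuous_at_imp_continuous_on ballI) (blast intro: has_vector_derivative_continuous)
    moreover have "((\<lambda>t. F (s * t)) has_derivative (\<lambda>x. x *\<^sub>R s *\<^sub>R F' (s * t))) (at t)"
      if "0 < t" "t < \<bar>h\<bar>" for t
      using D[of t] that by (simp add: has_vector_derivative_def)
    ultimately have "\<exists>t\<in>{0<..<\<bar>h\<bar>}. norm (F (s * \<bar>h\<bar>) - F (s * 0)) \<le> norm ((\<bar>h\<bar> - 0) *\<^sub>R s *\<^sub>R F' (s * t))"
      using that by (intro mvt_general[where f = "\<lambda>t. F (s * t)"]) auto
    then obtain t where t: "t \<in> {0<..<\<bar>h\<bar>}"
      and *: "norm (F (s * \<bar>h\<bar>) - F (s * 0)) \<le> norm ((\<bar>h\<bar> - 0) *\<^sub>R s *\<^sub>R F' (s * t))"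
      by blast
    have "norm (F h) \<le> \<bar>h\<bar> * norm (F' (s * t))"
      using * s assms(2) by (simp add: abs_mult)
    also have "norm (F' (s * t)) \<le> C * \<bar>s * t\<bar> ^ k"
      using t s small[of t] by (intro d(2)) auto
    also have "\<bar>s * t\<bar> ^ k \<le> \<bar>h\<bar> ^ k"
      using t s by (intro power_mono) (auto simp: abs_mult)
    finally show ?thesis using \<open>C > 0\<close> by (simp add: mult_left_mono mult.left_commute)
  qed
  have "\<forall>\<^sub>F h in at 0. norm (F h) \<le> C * \<bar>h\<bar> ^ Suc k"
    unfolding eventually_at using \<open>d > 0\<close> bound by (auto simp: dist_real_def)
  then show ?thesis by (rule vanishes_toI)
qed

text \<open>\<open>D m\<close> plays the role of the m-th derivative of \<open>D 0\<close>.
  Differentiating the remainder of length \<open>Suc n\<close> gives the remainder of length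
  \<open>n\<close> for the shifted sequence, so the induction hypothesis is integrated once.
  Boundedness of the top derivative starts the induction.\<close>

lemma vanishes_to_Taylor:
  fixes D :: "nat \<Rightarrow> real \<Rightarrow> 'a::real_inner"
  assumes "\<And>m. m < n \<Longrightarrow> \<forall>\<^sub>F h in nhds 0. (D m has_vector_derivative D (Suc m) h) (at h)"
    and "vanishes_to 0 (D n)"
  shows "vanishes_to n (\<lambda>h. D 0 h - (\<Sum>m<n. (h ^ m / fact m) *\<^sub>R D m 0))"
  using assms
proof (induction n arbitrary: D)
  case 0
  then show ?case by simp
next
  case (Suc n)
  have IH: "vanishes_to n (\<lambda>h. D (Suc 0) h - (\<Sum>m<n. (h ^ m / fact m) *\<^sub>R D (Suc m) 0))"
    using Suc.prems by (intro Suc.IH[of "\<lambda>m. D (Suc m)"]) auto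
  have P: "((\<lambda>h. \<Sum>m<Suc n. (h ^ m / fact m) *\<^sub>R D m 0) has_vector_derivative
      (\<Sum>m<n. (h ^ m / fact m) *\<^sub>R D (Suc m) 0)) (at h)" for h
  proof -
    \<comment> \<open>For \<open>m = 0\<close> the truncated exponent \<open>m - 1\<close> is
      harmless, since the coefficient \<open>real m\<close> is 0; for the same reason the sum loses
      its first term when shifted.\<close>
    have "((\<lambda>h. (h ^ m / fact m) *\<^sub>R D m 0) has_vector_derivative
        (real m * h ^ (m - 1) / fact m) *\<^sub>R D m 0) (at h)" for m
      by (auto intro!: derivative_eq_intros
          simp: has_real_derivative_iff_has_vector_derivative[symmetric])
    then have "((\<lambda>h. \<Sum>m<Suc n. (h ^ m / fact m) *\<^sub>R D m 0) has_vector_derivative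
      (\<Sum>m<Suc n. (real m * h ^ (m - 1) / fact m) *\<^sub>R D m 0)) (at h)"
      by (intro has_vector_derivative_sum)
    also have "(\<Sum>m<Suc n. (real m * h ^ (m - 1) / fact m) *\<^sub>R D m 0) =
        (\<Sum>m<n. (h ^ m / fact m) *\<^sub>R D (Suc m) 0)"
    proof -
      have "real (Suc m) * h ^ m / fact (Suc m) = h ^ m / fact m" for m
        by (simp del: of_nat_Suc)
      then show ?thesis by (subst sum.lessThan_Suc_shift) (simp del: of_nat_Suc fact_Suc)
    qed
    finally show ?thesis .
  qed
  show ?case
  proof (rule vanishes_to_antiderivative[OF _ _ IH])
    show "\<forall>\<^sub>F h in nhds 0. ((\<lambda>h. D 0 h - (\<Sum>m<Suc n. (h ^ m / fact m) *\<^sub>R D m 0)) has_vector_derivative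
        D (Suc 0) h - (\<Sum>m<n. (h ^ m / fact m) *\<^sub>R D (Suc m) 0)) (at h)"
      using Suc.prems(1)[OF zero_less_Suc] by eventually_elim (intro has_vector_derivative_diff P)
    show "D 0 0 - (\<Sum>m<Suc n. (0 ^ m / fact m) *\<^sub>R D m 0) = 0"
      by (subst sum.lessThan_Suc_shift) simp
  qed
qed

text \<open>By the chain rule, \<open>c ^ m\<close> times \<open>D m (c * h)\<close> is the m-th
  derivative of \<open>D 0 (c * h)\<close>. This serves for the solution at a node \<open>c\<close>,
  which may be 0 or negative.\<close>

lemma vanishes_to_Taylor_scaled:
  fixes D :: "nat \<Rightarrow> real \<Rightarrow> 'a::real_inner"
  assumes "\<And>m. m < n \<Longrightarrow> \<forall>\<^sub>F h in nhds 0. (D m has_vector_derivative D (Suc m) h) (at h)"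
    and "isCont (D n) 0"
  shows "vanishes_to n (\<lambda>h. D 0 (c * h) - (\<Sum>m<n. (h ^ m / fact m) *\<^sub>R c ^ m *\<^sub>R D m 0))"
proof -
  have lim: "((\<lambda>h. c * h) \<longlongrightarrow> 0) (nhds 0)"
    by (rule tendsto_mult_right_zero[OF filterlim_ident])
  have "vanishes_to n (\<lambda>h. c ^ 0 *\<^sub>R D 0 (c * h) - (\<Sum>m<n. (h ^ m / fact m) *\<^sub>R c ^ m *\<^sub>R D m (c * 0)))"
  proof (rule vanishes_to_Taylor[of n "\<lambda>m h. c ^ m *\<^sub>R D m (c * h)"])
    fix m assume "m < n"
    have "\<forall>\<^sub>F h in nhds 0. (D m has_vector_derivative D (Suc m) (c * h)) (at (c * h))"
      using eventually_compose_filterlim[OF assms(1)[OF \<open>m < n\<close>] lim] .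
    then show "\<forall>\<^sub>F h in nhds 0. ((\<lambda>h. c ^ m *\<^sub>R D m (c * h)) has_vector_derivative
        c ^ Suc m *\<^sub>R D (Suc m) (c * h)) (at h)"
    proof eventually_elim
      case (elim h)
      have "((\<lambda>t. c * t) has_vector_derivative c) (at h)"
        by (auto intro!: derivative_eq_intros simp: has_real_derivative_iff_has_vector_derivative[symmetric])
      from vector_diff_chain_at[OF this elim]
      have "((\<lambda>t. D m (c * t)) has_vector_derivative c *\<^sub>R D (Suc m) (c * h)) (at h)"
        by (simp add: o_def)
      then show ?case by (auto intro!: derivative_eq_intros)
    qed
  next
    have "isCont (\<lambda>h. D n (c * h)) 0"
      using assms(2) by (intro isCont_o2[of 0 "\<lambda>h. c * h" "D n"]) auto
    then have "isCont (\<lambda>h. c ^ n *\<^sub>R D n (c * h)) 0" by (intro continuous_intros)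
    then show "vanishes_to 0 (\<lambda>h. c ^ n *\<^sub>R D n (c * h))"
      by (intro vanishes_to_tendsto) (simp add: isCont_def)
  qed
  then show ?thesis by simp
qed

text \<open>A ladder of antiderivatives that starts from |cos| <= 1: each remainder vanishes at 0
  and has as derivative the one before it, up to the factor \<open>a\<close> or
  \<open>- a\<close>.\<close>

lemma vanishes_to_trig:
  fixes a :: real
  shows "vanishes_to 0 (\<lambda>h. cos (a * h))"
    and "vanishes_to 1 (\<lambda>h. sin (a * h))"
    and "vanishes_to 2 (\<lambda>h. cos (a * h) - 1)"
    and "vanishes_to 3 (\<lambda>h. sin (a * h) - a * h)"
    and "vanishes_to 4 (\<lambda>h. cos (a * h) - 1 + (a * h)\<^sup>2 / 2)"
    and "vanishes_to 5 (\<lambda>h. sin (a * h) - a * h + (a * h) ^ 3 / 6)"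
    and "vanishes_to 6 (\<lambda>h. cos (a * h) - 1 + (a * h)\<^sup>2 / 2 - (a * h) ^ 4 / 24)"
proof -
  note simps = has_real_derivative_iff_has_vector_derivative[symmetric]
  note step = vanishes_to_antiderivative[OF always_eventually]
  show 0: "vanishes_to 0 (\<lambda>h. cos (a * h))"
    by (rule vanishes_toI[of _ 1]) simp
  have "vanishes_to (Suc 0) (\<lambda>h. sin (a * h))"
    by (rule step[OF _ _ vanishes_to_cmult[OF 0, of a]])
      (auto simp: simps intro!: derivative_eq_intros)
  then show 1: "vanishes_to 1 (\<lambda>h. sin (a * h))" by simp
  have "vanishes_to (Suc 1) (\<lambda>h. cos (a * h) - 1)"
    by (rule step[OF _ _ vanishes_to_cmult[OF 1, of "- a"]])
      (auto simp: simps intro!: derivative_eq_intros)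
  then show 2: "vanishes_to 2 (\<lambda>h. cos (a * h) - 1)" by (simp add: numeral_2_eq_2)
  have "vanishes_to (Suc 2) (\<lambda>h. sin (a * h) - a * h)"
    by (rule step[OF _ _ vanishes_to_cmult[OF 2, of a]])
      (auto simp: simps algebra_simps intro!: derivative_eq_intros)
  then show 3: "vanishes_to 3 (\<lambda>h. sin (a * h) - a * h)" by simp
  have "vanishes_to (Suc 3) (\<lambda>h. cos (a * h) - 1 + (a * h)\<^sup>2 / 2)"
    by (rule step[OF _ _ vanishes_to_cmult[OF 3, of "- a"]])
      (auto simp: simps algebra_simps power2_eq_square eval_nat_numeral intro!: derivative_eq_intros)
  then show 4: "vanishes_to 4 (\<lambda>h. cos (a * h) - 1 + (a * h)\<^sup>2 / 2)" by simp
  have "vanishes_to (Suc 4) (\<lambda>h. sin (a * h) - a * h + (a * h) ^ 3 / 6)"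
    by (rule step[OF _ _ vanishes_to_cmult[OF 4, of a]])
      (auto simp: simps algebra_simps power2_eq_square eval_nat_numeral intro!: derivative_eq_intros)
  then show 5: "vanishes_to 5 (\<lambda>h. sin (a * h) - a * h + (a * h) ^ 3 / 6)" by simp
  have "vanishes_to (Suc 5) (\<lambda>h. cos (a * h) - 1 + (a * h)\<^sup>2 / 2 - (a * h) ^ 4 / 24)"
    by (rule step[OF _ _ vanishes_to_cmult[OF 5, of "- a"]])
      (auto simp: simps algebra_simps power2_eq_square eval_nat_numeral intro!: derivative_eq_intros)
  then show "vanishes_to 6 (\<lambda>h. cos (a * h) - 1 + (a * h)\<^sup>2 / 2 - (a * h) ^ 4 / 24)" by simp
qed

section \<open>Smooth vector fields and Lie derivatives\<close>

lemma C_on_differentiable: "C_on (Suc k) f U \<Longrightarrow> x \<in> U \<Longrightarrow> f differentiable at x"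
  by simp

lemma C_on_has_derivative:
  "C_on (Suc k) f U \<Longrightarrow> x \<in> U \<Longrightarrow> (f has_derivative frechet_derivative f (at x)) (at x)"
  by (rule iffD1[OF frechet_derivative_works]) simp

lemma C_on_deriv: "C_on (Suc k) f U \<Longrightarrow> C_on k (\<lambda>x. frechet_derivative f (at x) v) U"
  by simp

lemma C_on_Suc_imp: "C_on (Suc k) f U \<Longrightarrow> C_on k f U"
proof (induction k arbitrary: f)
  case 0
  then show ?case
    by (simp add: continuous_at_imp_continuous_on differentiable_imp_continuous_within)
next
  case (Suc k)
  show ?case
    using C_on_differentiable[OF Suc.prems] Suc.IH[OF C_on_deriv[OF Suc.prems]]
    by (simp only: C_on.simps(2)) blast
qed

lemma C_on_mono: "C_on k f U \<Longrightarrow> j \<le> k \<Longrightarrow> C_on j f U"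
proof (induction k)
  case (Suc k)
  then show ?case using C_on_Suc_imp[OF Suc.prems(1)] by (cases "j = Suc k") auto
qed simp

lemma C_on_continuous: "C_on k f U \<Longrightarrow> continuous_on U f"
  using C_on_mono[of k f U 0] by simp

text \<open>Openness of \<open>U\<close> matters: a derivative at \<open>x\<close> depends on the
  values around \<open>x\<close>, so functions that agree on \<open>U\<close> have the same
  derivatives there.\<close>

lemma C_on_cong:
  assumes "open U" "\<And>x. x \<in> U \<Longrightarrow> f x = g x" "C_on k f U"
  shows "C_on k g U"
  using assms(2,3)
proof (induction k arbitrary: f g)
  case 0
  then show ?case by (metis C_on.simps(1) continuous_on_cong)
next
  case (Suc k)
  have der: "(g has_derivative frechet_derivative f (at x)) (at x)" if "x \<in> U" for x
    using C_on_has_derivative[OF Suc.prems(2) that] assms(1) that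
    by (rule has_derivative_transform_within_open) (use Suc.prems(1) in auto)
  then have eq: "frechet_derivative f (at x) = frechet_derivative g (at x)" if "x \<in> U" for x
    using that by (blast intro: frechet_derivative_at)
  have "C_on k (\<lambda>x. frechet_derivative g (at x) v) U" for v
    by (rule Suc.IH[OF _ C_on_deriv[OF Suc.prems(2)]]) (simp only: eq)
  with der show ?case by (auto simp: differentiable_def)
qed

text \<open>The recursion of \<open>C_on\<close> speaks of \<open>frechet_derivative\<close>; by
  uniqueness of derivatives, whatever \<open>f'\<close> a differentiation rule supplies may replace
  it.\<close>

lemma C_on_SucI:
  assumes "open U" "\<And>x. x \<in> U \<Longrightarrow> (f has_derivative f' x) (at x)"
    and "\<And>v. C_on k (\<lambda>x. f' x v) U"
  shows "C_on (Suc k) f U"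
proof -
  have "C_on k (\<lambda>x. frechet_derivative f (at x) v) U" for v
  proof (rule C_on_cong[OF assms(1) _ assms(3)])
    show "f' x v = frechet_derivative f (at x) v" if "x \<in> U" for x
      using frechet_derivative_at[OF assms(2)[OF that]] by simp
  qed
  then show ?thesis using assms(2) by (auto simp: differentiable_def)
qed

lemma C_on_add:
  "open U \<Longrightarrow> C_on k f U \<Longrightarrow> C_on k g U \<Longrightarrow> C_on k (\<lambda>x. f x + g x) U"
proof (induction k arbitrary: f g)
  case 0
  then show ?case by (simp add: continuous_on_add)
next
  case (Suc k)
  show ?case
    by (rule C_on_SucI[OF Suc.prems(1) has_derivative_add[OF
            C_on_has_derivative[OF Suc.prems(2)] C_on_has_derivative[OF Suc.prems(3)]]])
      (assumption, assumption,
        rule Suc.IH[OF Suc.prems(1) C_on_deriv[OF Suc.prems(2)] C_on_deriv[OF Suc.prems(3)]])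
qed

lemma C_on_const: "C_on k (\<lambda>_. c) U"
  by (induction k arbitrary: c) auto

lemma C_on_sum:
  "open U \<Longrightarrow> (\<And>i. i \<in> I \<Longrightarrow> C_on k (f i) U) \<Longrightarrow> C_on k (\<lambda>x. \<Sum>i\<in>I. f i x) U"
  by (induction I rule: infinite_finite_induct) (simp_all add: C_on_const C_on_add)

lemma C_on_scaleR:
  "open U \<Longrightarrow> C_on k a U \<Longrightarrow> C_on k f U \<Longrightarrow> C_on k (\<lambda>x. a x *\<^sub>R f x) U"
proof (induction k arbitrary: a f)
  case 0
  then show ?case by (simp add: continuous_on_scaleR)
next
  case (Suc k)
  show ?case
  proof (rule C_on_SucI[OF Suc.prems(1) has_derivative_scaleR[OF
          C_on_has_derivative[OF Suc.prems(2)] C_on_has_derivative[OF Suc.prems(3)]]], assumption, assumption)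
    show "C_on k (\<lambda>x. a x *\<^sub>R frechet_derivative f (at x) v
        + frechet_derivative a (at x) v *\<^sub>R f x) U" for v
      by (intro C_on_add[OF Suc.prems(1)] Suc.IH[OF Suc.prems(1)]
          C_on_deriv[OF Suc.prems(2)] C_on_deriv[OF Suc.prems(3)]
          C_on_Suc_imp[OF Suc.prems(2)] C_on_Suc_imp[OF Suc.prems(3)])
  qed
qed

lemma C_on_inner_const:
  "open U \<Longrightarrow> C_on k f U \<Longrightarrow> C_on k (\<lambda>x. f x \<bullet> b) U"
proof (induction k arbitrary: f)
  case 0
  then show ?case by (simp add: continuous_on_inner)
next
  case (Suc k)
  show ?case
    by (rule C_on_SucI[OF Suc.prems(1) has_derivative_inner_left[OF
            C_on_has_derivative[OF Suc.prems(2)]]])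
      (assumption, rule Suc.IH[OF Suc.prems(1) C_on_deriv[OF Suc.prems(2)]])
qed

section \<open>Lie derivatives and derivatives of the solution\<close>

text \<open>\<open>C_on\<close> controls the derivative only in fixed directions. Expanding the
  direction in the basis reduces an \<open>x\<close>-dependent direction such as \<open>f x\<close>
  to these.\<close>

lemma frechet_derivative_euclidean_expansion:
  fixes F :: "'a::euclidean_space \<Rightarrow> 'b::real_normed_vector"
  assumes "F differentiable at x"
  shows "frechet_derivative F (at x) v = (\<Sum>b\<in>Basis. (v \<bullet> b) *\<^sub>R frechet_derivative F (at x) b)"
proof -
  have lin: "linear (frechet_derivative F (at x))"
    using assms by (rule linear_frechet_derivative)
  have "frechet_derivative F (at x) v = frechet_derivative F (at x) (\<Sum>b\<in>Basis. (v \<bullet> b) *\<^sub>R b)"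
    by (simp add: euclidean_representation)
  also have "\<dots> = (\<Sum>b\<in>Basis. (v \<bullet> b) *\<^sub>R frechet_derivative F (at x) b)"
    by (simp add: linear_sum[OF lin] linear_scale[OF lin])
  finally show ?thesis .
qed

text \<open>The derivative of \<open>F\<close> along the flow of \<open>f\<close>. Along a solution,
  \<open>(lie_derivative f ^^ k) f\<close> is the derivative of order \<open>k + 1\<close> of
  \<open>y\<close>; the case \<open>k = 1\<close> is the field g of the method.\<close>

definition lie_derivative ::
  "('a::euclidean_space \<Rightarrow> 'a) \<Rightarrow> ('a \<Rightarrow> 'b::euclidean_space) \<Rightarrow> 'a \<Rightarrow> 'b" where
  "lie_derivative f F x = frechet_derivative F (at x) (f x)"

lemma C_on_lie_derivative:
  assumes "open U" "C_on (Suc k) F U" "C_on k f U"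
  shows "C_on k (lie_derivative f F) U"
proof (rule C_on_cong[OF assms(1)])
  show "C_on k (\<lambda>x. \<Sum>b\<in>Basis. (f x \<bullet> b) *\<^sub>R frechet_derivative F (at x) b) U"
    using assms by (intro C_on_sum C_on_scaleR C_on_inner_const C_on_deriv)
  show "(\<Sum>b\<in>Basis. (f x \<bullet> b) *\<^sub>R frechet_derivative F (at x) b) = lie_derivative f F x"
    if "x \<in> U" for x
    unfolding lie_derivative_def
    by (rule frechet_derivative_euclidean_expansion[OF C_on_differentiable[OF assms(2) that], symmetric])
qed

text \<open>Each Lie derivative costs one order of smoothness.\<close>

lemma C_on_lie_derivative_funpow:
  assumes "open U" "C_on p f U" "k \<le> p"
  shows "C_on (p - k) ((lie_derivative f ^^ k) f) U"
  using assms(3)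
proof (induction k)
  case 0
  then show ?case using assms by simp
next
  case (Suc k)
  have "C_on (Suc (p - Suc k)) ((lie_derivative f ^^ k) f) U"
    using Suc by (simp del: C_on.simps add: Suc_diff_Suc)
  with assms show ?case
    by (auto simp del: C_on.simps intro!: C_on_lie_derivative intro: C_on_mono)
qed

lemma has_vector_derivative_along_solution:
  assumes "C_on (Suc k) F U" "y t \<in> U" "(y has_vector_derivative f (y t)) (at t)"
  shows "((\<lambda>t. F (y t)) has_vector_derivative lie_derivative f F (y t)) (at t)"
  using has_derivative_compose[OF assms(3)[unfolded has_vector_derivative_def]
      C_on_has_derivative[OF assms(1,2)]]
  by (simp add: has_vector_derivative_def lie_derivative_def
      linear_scale[OF linear_frechet_derivative[OF C_on_differentiable[OF assms(1,2)]]])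

section \<open>Lipschitz bounds and contraction on a ball\<close>

text \<open>The partial derivatives are bounded on the compact ball, their bounds add up to a bound
  of the operator norm, and convexity of the ball lets the mean value inequality turn it into a
  Lipschitz constant.\<close>

lemma C_on_1_lipschitz_cball:
  fixes g :: "'a::euclidean_space \<Rightarrow> 'b::euclidean_space"
  assumes "C_on 1 g U" "cball y0 r \<subseteq> U"
  obtains L where "L > 0"
    "\<And>x z. x \<in> cball y0 r \<Longrightarrow> z \<in> cball y0 r \<Longrightarrow> norm (g x - g z) \<le> L * norm (x - z)"
proof -
  have g: "C_on (Suc 0) g U" using assms(1) by simp
  have "\<exists>B. \<forall>x\<in>cball y0 r. norm (frechet_derivative g (at x) b) \<le> B" for b
  proof -
    have "continuous_on (cball y0 r) (\<lambda>x. frechet_derivative g (at x) b)"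
      by (rule continuous_on_subset[OF C_on_continuous[OF C_on_deriv[OF g]] assms(2)])
    then have "bounded ((\<lambda>x. frechet_derivative g (at x) b) ` cball y0 r)"
      by (intro compact_imp_bounded compact_continuous_image) auto
    then show ?thesis by (auto simp: bounded_iff)
  qed
  then obtain B where B: "\<And>b x. x \<in> cball y0 r \<Longrightarrow> norm (frechet_derivative g (at x) b) \<le> B b"
    by metis
  define L where "L = (\<Sum>b\<in>Basis. B b)"
  have L: "onorm (frechet_derivative g (at x)) \<le> L" if x: "x \<in> cball y0 r" for x
  proof (rule onorm_le)
    fix v
    have "norm (frechet_derivative g (at x) v) \<le> (\<Sum>b\<in>Basis. norm v * B b)"
      unfolding frechet_derivative_euclidean_expansion[OF C_on_differentiable[OF g subsetD[OF assms(2) x]], of v]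
    proof (rule sum_norm_le)
      fix b :: 'a assume "b \<in> Basis"
      then show "norm ((v \<bullet> b) *\<^sub>R frechet_derivative g (at x) b) \<le> norm v * B b"
        using B[OF x, of b] Basis_le_norm[of b v] by (auto intro!: mult_mono)
    qed
    then show "norm (frechet_derivative g (at x) v) \<le> L * norm v"
      by (simp add: L_def sum_distrib_left mult.commute)
  qed
  have "norm (g x - g z) \<le> L * norm (x - z)" if "x \<in> cball y0 r" "z \<in> cball y0 r" for x z
  proof (rule differentiable_bound[OF convex_cball _ L that])
    show "(g has_derivative frechet_derivative g (at x)) (at x within cball y0 r)"
      if "x \<in> cball y0 r" for x
      using C_on_has_derivative[OF g] that assms(2) by (blast intro: has_derivative_at_withinI)
  qed
  then have "norm (g x - g z) \<le> (\<bar>L\<bar> + 1) * norm (x - z)"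
    if "x \<in> cball y0 r" "z \<in> cball y0 r" for x z
    using that by (smt (verit) mult_right_mono norm_ge_zero)
  then show ?thesis by (intro that[of "\<bar>L\<bar> + 1"]) auto
qed

text \<open>Banach's theorem wants the complete closed ball. The strict bound makes the map send it
  into the open ball, so the unique fixed point in the closed ball already lies in the open
  one.\<close>

lemma perturbed_fixed_point_in_ball:
  fixes g :: "'a::euclidean_space \<Rightarrow> 'a"
  assumes "r > 0"
    and lip: "\<And>x z. x \<in> cball y0 r \<Longrightarrow> z \<in> cball y0 r \<Longrightarrow> norm (g x - g z) \<le> L * norm (x - z)"
    and bound: "\<And>x. x \<in> cball y0 r \<Longrightarrow> norm (g x) \<le> B"
    and contr: "\<bar>\<alpha>\<bar> * L < 1" and small: "norm (A - y0) + \<bar>\<alpha>\<bar> * B < r"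
  shows "\<exists>!z. z \<in> ball y0 r \<and> z = A + \<alpha> *\<^sub>R g z"
proof -
  have self: "A + \<alpha> *\<^sub>R g z \<in> ball y0 r" if "z \<in> cball y0 r" for z
  proof -
    have "norm (A + \<alpha> *\<^sub>R g z - y0) \<le> norm (A - y0) + \<bar>\<alpha>\<bar> * norm (g z)"
    proof -
      have "A + \<alpha> *\<^sub>R g z - y0 = (A - y0) + \<alpha> *\<^sub>R g z" by simp
      then show ?thesis by (metis norm_triangle_ineq norm_scaleR)
    qed
    also have "\<dots> \<le> norm (A - y0) + \<bar>\<alpha>\<bar> * B"
      using bound[OF that] by (intro add_left_mono mult_left_mono) auto
    finally show ?thesis using small by (simp add: dist_norm norm_minus_commute)
  qed
  have "\<exists>!z\<in>cball y0 r. A + \<alpha> *\<^sub>R g z = z"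
  \<comment> \<open>The sign of \<open>L\<close> is not fixed, while Banach's theorem asks for a
    nonnegative constant.\<close>
  proof (rule Banach_fix[where c = "max 0 (\<bar>\<alpha>\<bar> * L)"])
    show "(\<lambda>z. A + \<alpha> *\<^sub>R g z) ` cball y0 r \<subseteq> cball y0 r"
      using self ball_subset_cball by blast
    fix x z assume xz: "x \<in> cball y0 r" "z \<in> cball y0 r"
    have "dist (A + \<alpha> *\<^sub>R g x) (A + \<alpha> *\<^sub>R g z) = \<bar>\<alpha>\<bar> * norm (g x - g z)"
      by (simp add: dist_norm flip: scaleR_diff_right)
    also have "\<dots> \<le> \<bar>\<alpha>\<bar> * L * dist x z"
      using mult_left_mono[OF lip[OF xz], of "\<bar>\<alpha>\<bar>"] by (simp add: dist_norm mult.assoc)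
    also have "\<dots> \<le> max 0 (\<bar>\<alpha>\<bar> * L) * dist x z"
      by (intro mult_right_mono) auto
    finally show "dist (A + \<alpha> *\<^sub>R g x) (A + \<alpha> *\<^sub>R g z) \<le> max 0 (\<bar>\<alpha>\<bar> * L) * dist x z" .
  qed (use assms in \<open>auto simp: complete_eq_closed\<close>)
  then show ?thesis using self ball_subset_cball by (smt (verit, best) subsetD)
qed

section \<open>The fitting conditions\<close>

lemma Eplus_analytic [analytic_intros]: "(\<lambda>\<mu>. Eplus \<zeta> \<mu>) analytic_on S"
  unfolding Eplus_def by (intro analytic_intros)

lemma Eminus_analytic [analytic_intros]: "(\<lambda>\<mu>. Eminus \<zeta> \<mu>) analytic_on S"
  unfolding Eminus_def by (intro analytic_intros)

text \<open>At an admissible nonzero point each quotient is analytic, so \<open>remove_sings\<close>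
  leaves its value unchanged. The xi coefficients enter the fitting conditions only multiplied by
  their nodes; stated for these products, the formula covers \<open>c1 = 0\<close>, where both sides
  vanish.\<close>

lemma ef_coeffs_eq:
  assumes "ef_admissible c1 c2 \<mu>" "\<mu> \<noteq> 0" "c2 \<noteq> 0"
  shows "ef_a11 c1 \<mu> = 1 / \<mu>^2 * (1 - 2 / Eplus c1 \<mu>)"
    and "ef_a22 c1 c2 \<phi> \<mu> = (Eplus c2 \<mu> - (2 + \<phi> * \<mu>^2 * Eplus c1 \<mu>)) / (\<mu>^2 * Eplus c2 \<mu>)"
    and "ef_xi1 c1 \<mu> * c1 = Eminus c1 \<mu> / (\<mu> * Eplus c1 \<mu>)"
    and "ef_xi2 c1 c2 \<phi> \<mu> * c2
      = (Eminus c2 \<mu> - \<phi> * \<mu>^2 * Eminus (c1 - c2) \<mu>) / (\<mu> * Eplus c2 \<mu>)"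
    and "ef_b1 c1 c2 \<mu>
      = (Eminus c2 \<mu> + Eminus (1 - c2) \<mu> - \<mu> * Eplus c2 \<mu>) / (\<mu>^2 * Eminus (c1 - c2) \<mu>)"
    and "ef_b2 c1 c2 \<mu>
      = (\<mu> * Eplus c1 \<mu> - Eminus c1 \<mu> - Eminus (1 - c1) \<mu>) / (\<mu>^2 * Eminus (c1 - c2) \<mu>)"
proof -
  have nz: "Eplus c1 \<mu> \<noteq> 0" "Eplus c2 \<mu> \<noteq> 0" "Eminus (c1 - c2) \<mu> \<noteq> 0"
    using assms by (auto simp: ef_admissible_def)
  show "ef_a11 c1 \<mu> = 1 / \<mu>^2 * (1 - 2 / Eplus c1 \<mu>)"
    unfolding ef_a11_def
    by (subst remove_sings_at_analytic) (use nz assms in \<open>auto intro!: analytic_intros\<close>)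
  show "ef_a22 c1 c2 \<phi> \<mu> = (Eplus c2 \<mu> - (2 + \<phi> * \<mu>^2 * Eplus c1 \<mu>)) / (\<mu>^2 * Eplus c2 \<mu>)"
    unfolding ef_a22_def
    by (subst remove_sings_at_analytic) (use nz assms in \<open>auto intro!: analytic_intros\<close>)
  show "ef_xi1 c1 \<mu> * c1 = Eminus c1 \<mu> / (\<mu> * Eplus c1 \<mu>)"
  proof (cases "c1 = 0")
    case True
    then show ?thesis by (simp add: Eminus_def)
  next
    case False
    then have "ef_xi1 c1 \<mu> = Eminus c1 \<mu> / (c1 * \<mu> * Eplus c1 \<mu>)"
      unfolding ef_xi1_def if_not_P[OF False]
      by (subst remove_sings_at_analytic) (use nz assms in \<open>auto intro!: analytic_intros\<close>)
    with False show ?thesis by simp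
  qed
  have "ef_xi2 c1 c2 \<phi> \<mu>
      = (Eminus c2 \<mu> - \<phi> * \<mu>^2 * Eminus (c1 - c2) \<mu>) / (c2 * \<mu> * Eplus c2 \<mu>)"
    unfolding ef_xi2_def
    by (subst remove_sings_at_analytic) (use nz assms in \<open>auto intro!: analytic_intros\<close>)
  with assms(3) show "ef_xi2 c1 c2 \<phi> \<mu> * c2
      = (Eminus c2 \<mu> - \<phi> * \<mu>^2 * Eminus (c1 - c2) \<mu>) / (\<mu> * Eplus c2 \<mu>)"
    by simp
  show "ef_b1 c1 c2 \<mu>
      = (Eminus c2 \<mu> + Eminus (1 - c2) \<mu> - \<mu> * Eplus c2 \<mu>) / (\<mu>^2 * Eminus (c1 - c2) \<mu>)"
    unfolding ef_b1_def
    by (subst remove_sings_at_analytic) (use nz assms in \<open>auto intro!: analytic_intros\<close>)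
  show "ef_b2 c1 c2 \<mu>
      = (\<mu> * Eplus c1 \<mu> - Eminus c1 \<mu> - Eminus (1 - c1) \<mu>) / (\<mu>^2 * Eminus (c1 - c2) \<mu>)"
    unfolding ef_b2_def
    by (subst remove_sings_at_analytic) (use nz assms in \<open>auto intro!: analytic_intros\<close>)
qed

text \<open>With \<open>p\<close> and \<open>p'\<close> standing for \<open>exp (c1 * \<mu>)\<close>
  and \<open>exp (- c1 * \<mu>)\<close>, and \<open>m\<close> for \<open>\<mu>\<close>, the two
  signs of the fitting condition become rational identities in free variables.\<close>

lemma fitting_first_stage:
  fixes p p' m :: complex
  assumes "p + p' \<noteq> 0" "m \<noteq> 0"
  shows "m^2 * (1 / m^2 * (1 - 2 / (p + p')) * p) + (p - p') / (m * (p + p')) * m = p - 1"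
    and "m^2 * (1 / m^2 * (1 - 2 / (p + p')) * p') - (p - p') / (m * (p + p')) * m = p' - 1"
  using assms by (simp_all add: divide_simps) (simp_all add: algebra_simps)

lemma fitting_second_stage:
  fixes p p' q q' m \<phi> :: complex
  assumes "q + q' \<noteq> 0" "m \<noteq> 0"
  defines "a \<equiv> (q + q' - (2 + \<phi> * m^2 * (p + p'))) / (m^2 * (q + q'))"
    and "x \<equiv> (q - q' - \<phi> * m^2 * (p * q' - p' * q)) / (m * (q + q'))"
  shows "m^2 * (\<phi> * p + a * q) + x * m = q - 1"
    and "m^2 * (\<phi> * p' + a * q') - x * m = q' - 1"
  unfolding a_def x_def using assms(1,2) by (simp_all add: divide_simps) algebra+

text \<open>Cramer's rule for the 2x2 system in the weights: its determinant
  \<open>p * q' - p' * q\<close> is \<open>Eminus (c1 - c2) \<mu>\<close>, which admissibility keeps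
  nonzero for nonzero \<open>\<mu>\<close>.\<close>

lemma fitting_quadrature:
  fixes p p' q q' e e' m :: complex
  assumes "p * q' - p' * q \<noteq> 0" "m \<noteq> 0"
  defines "b1 \<equiv> (q - q' + (e * q' - e' * q) - m * (q + q')) / (m^2 * (p * q' - p' * q))"
    and "b2 \<equiv> (m * (p + p') - (p - p') - (e * p' - e' * p)) / (m^2 * (p * q' - p' * q))"
  shows "m^2 * (b1 * p + b2 * q) = e - 1 - m" and "m^2 * (b1 * p' + b2 * q') = e' - 1 + m"
  unfolding b1_def b2_def using assms(1,2) by (simp_all add: divide_simps) algebra+

lemma Eminus_diff:
  "Eminus (a - b) \<mu> = exp (a * \<mu>) * exp (- b * \<mu>) - exp (- a * \<mu>) * exp (b * \<mu>)"
  by (simp add: Eminus_def algebra_simps flip: exp_add)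

lemma ef_tddirk_fitting_conditions:
  assumes "ef_admissible c1 c2 \<mu>" "c2 \<noteq> 0"
  shows "fitting_conditions (ef_tddirk c1 c2 \<phi>) \<mu>"
proof (cases "\<mu> = 0")
  case True
  \<comment> \<open>At \<open>\<mu> = 0\<close> every term has a factor \<open>\<mu>\<close> or is
    \<open>exp 0 - 1\<close>, so both sides are 0 whatever values fill the singularities.\<close>
  then show ?thesis by (simp add: fitting_conditions_def)
next
  case False
  define p p' q q' e e' where "p = exp (c1 * \<mu>)" "p' = exp (- c1 * \<mu>)" "q = exp (c2 * \<mu>)"
    "q' = exp (- c2 * \<mu>)" "e = exp \<mu>" "e' = exp (- \<mu>)"
  note defs = this
  have E: "Eplus c1 \<mu> = p + p'" "Eplus c2 \<mu> = q + q'" "Eminus c1 \<mu> = p - p'" "Eminus c2 \<mu> = q - q'"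
    "Eminus (c1 - c2) \<mu> = p * q' - p' * q" "Eminus (1 - c1) \<mu> = e * p' - e' * p"
    "Eminus (1 - c2) \<mu> = e * q' - e' * q"
    by (simp_all only: Eminus_diff) (simp_all add: Eplus_def Eminus_def defs)
  have nz: "p + p' \<noteq> 0" "q + q' \<noteq> 0" "p * q' - p' * q \<noteq> 0"
    using assms(1) False unfolding ef_admissible_def E by auto
  have I: "{1..2::nat} = {1, 2}" "{1..1::nat} = {1}" "{Suc 0..2} = {1, 2}" by auto
  note coeffs = ef_coeffs_eq[OF assms(1) False assms(2), unfolded E]
  have first: "\<mu>^2 * (ef_a11 c1 \<mu> * p) + ef_xi1 c1 \<mu> * c1 * \<mu> = p - 1"
    "\<mu>^2 * (ef_a11 c1 \<mu> * p') - ef_xi1 c1 \<mu> * c1 * \<mu> = p' - 1"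
    unfolding coeffs by (rule fitting_first_stage[OF nz(1) False])+
  have second: "\<mu>^2 * (\<phi> * p + ef_a22 c1 c2 \<phi> \<mu> * q) + ef_xi2 c1 c2 \<phi> \<mu> * c2 * \<mu> = q - 1"
    "\<mu>^2 * (\<phi> * p' + ef_a22 c1 c2 \<phi> \<mu> * q') - ef_xi2 c1 c2 \<phi> \<mu> * c2 * \<mu> = q' - 1"
    unfolding coeffs by (rule fitting_second_stage[OF nz(2) False])+
  have quadrature: "\<mu>^2 * (ef_b1 c1 c2 \<mu> * p + ef_b2 c1 c2 \<mu> * q) = e - 1 - \<mu>"
    "\<mu>^2 * (ef_b1 c1 c2 \<mu> * p' + ef_b2 c1 c2 \<mu> * q') = e' - 1 + \<mu>"
    unfolding coeffs by (rule fitting_quadrature[OF nz(3) False])+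
  show ?thesis
    unfolding fitting_conditions_def I
    using first second quadrature by (simp add: ef_tddirk_def I defs)
qed

section \<open>Real form of the fitting conditions\<close>

lemma exp_mu: "exp (complex_of_real c * mu \<omega> h) = cis (c * \<omega> * h)"
  by (simp add: mu_def cis_conv_exp mult_ac)

lemma mu_squared: "(mu \<omega> h)\<^sup>2 = - complex_of_real ((\<omega> * h)\<^sup>2)"
  by (simp add: mu_def power_mult_distrib)

text \<open>Half the sum of the real parts for \<open>s = 1\<close> and \<open>s = -1\<close> is the
  cosine equation, half the difference of the imaginary parts the sine equation; the imaginary parts
  of \<open>a\<close>, \<open>b\<close> and \<open>x\<close> cancel. The shape covers the stages
  (\<open>k = c\<close>) and the quadrature (\<open>k = 1\<close>, \<open>x = 1\<close>).\<close>

lemma fitting_pair_real_form: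
  fixes a b x :: complex
  assumes "\<And>s. s \<in> {1, -1 :: complex} \<Longrightarrow>
    (mu \<omega> h)\<^sup>2 * (a * exp (s * complex_of_real d * mu \<omega> h) + b * exp (s * complex_of_real c * mu \<omega> h))
      + s * x * mu \<omega> h = exp (s * complex_of_real k * mu \<omega> h) - 1"
  shows "(\<omega> * h)\<^sup>2 * (Re a * cos (d * \<omega> * h) + Re b * cos (c * \<omega> * h)) = 1 - cos (k * \<omega> * h)"
    and "Re x * (\<omega> * h) - (\<omega> * h)\<^sup>2 * (Re a * sin (d * \<omega> * h) + Re b * sin (c * \<omega> * h)) = sin (k * \<omega> * h)"
proof -
  have minus: "exp (- 1 * complex_of_real r * mu \<omega> h) = cis (- (r * \<omega> * h))" for r
    using exp_mu[of "- r"] by simp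
  have p: "- complex_of_real ((\<omega> * h)\<^sup>2) * (a * cis (d * \<omega> * h) + b * cis (c * \<omega> * h))
      + x * mu \<omega> h = cis (k * \<omega> * h) - 1"
    using assms[of 1] by (simp add: exp_mu mu_squared)
  have m: "- complex_of_real ((\<omega> * h)\<^sup>2) * (a * cis (- (d * \<omega> * h)) + b * cis (- (c * \<omega> * h)))
      - x * mu \<omega> h = cis (- (k * \<omega> * h)) - 1"
    using assms[of "-1"] unfolding minus mu_squared by simp
  show "(\<omega> * h)\<^sup>2 * (Re a * cos (d * \<omega> * h) + Re b * cos (c * \<omega> * h)) = 1 - cos (k * \<omega> * h)"
    using arg_cong[OF p, of Re] arg_cong[OF m, of Re] by (simp add: mu_def algebra_simps)
  show "Re x * (\<omega> * h) - (\<omega> * h)\<^sup>2 * (Re a * sin (d * \<omega> * h) + Re b * sin (c * \<omega> * h)) = sin (k * \<omega> * h)"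
    using arg_cong[OF p, of Im] arg_cong[OF m, of Im] by (simp add: mu_def algebra_simps)
qed

lemma fitting_conditions_real_form:
  assumes "fitting_conditions M (mu \<omega> h)"
  defines "\<theta> \<equiv> \<omega> * h"
  shows "\<theta>\<^sup>2 * (Re (acoef M 1 1 (mu \<omega> h)) * cos (cnode M 1 * \<omega> * h)) = 1 - cos (cnode M 1 * \<omega> * h)"
    and "Re (xicoef M 1 (mu \<omega> h)) * cnode M 1 * \<theta>
      - \<theta>\<^sup>2 * (Re (acoef M 1 1 (mu \<omega> h)) * sin (cnode M 1 * \<omega> * h)) = sin (cnode M 1 * \<omega> * h)"
    and "\<theta>\<^sup>2 * (Re (acoef M 2 1 (mu \<omega> h)) * cos (cnode M 1 * \<omega> * h)
      + Re (acoef M 2 2 (mu \<omega> h)) * cos (cnode M 2 * \<omega> * h)) = 1 - cos (cnode M 2 * \<omega> * h)"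
    and "Re (xicoef M 2 (mu \<omega> h)) * cnode M 2 * \<theta>
      - \<theta>\<^sup>2 * (Re (acoef M 2 1 (mu \<omega> h)) * sin (cnode M 1 * \<omega> * h)
      + Re (acoef M 2 2 (mu \<omega> h)) * sin (cnode M 2 * \<omega> * h)) = sin (cnode M 2 * \<omega> * h)"
    and "\<theta>\<^sup>2 * (Re (bcoef M 1 (mu \<omega> h)) * cos (cnode M 1 * \<omega> * h)
      + Re (bcoef M 2 (mu \<omega> h)) * cos (cnode M 2 * \<omega> * h)) = 1 - cos \<theta>"
    and "\<theta>\<^sup>2 * (Re (bcoef M 1 (mu \<omega> h)) * sin (cnode M 1 * \<omega> * h)
      + Re (bcoef M 2 (mu \<omega> h)) * sin (cnode M 2 * \<omega> * h)) = \<theta> - sin \<theta>"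
proof -
  let ?m = "mu \<omega> h" and ?c = "\<lambda>i. complex_of_real (cnode M i)"
  have I: "{1..2::nat} = {1, 2}" "{1..1::nat} = {1}" "{Suc 0..2} = {1, 2}" by auto
  \<comment> \<open>The first stage has only one term and gets a second one with weight 0; in the
    quadrature condition \<open>s * ?m\<close> moves to the left, where it acts as
    \<open>x = 1\<close>.\<close>
  have eqs: "?m\<^sup>2 * (0 * exp (s * ?c 1 * ?m) + acoef M 1 1 ?m * exp (s * ?c 1 * ?m))
      + s * (xicoef M 1 ?m * ?c 1) * ?m = exp (s * ?c 1 * ?m) - 1"
    "?m\<^sup>2 * (acoef M 2 1 ?m * exp (s * ?c 1 * ?m) + acoef M 2 2 ?m * exp (s * ?c 2 * ?m))
      + s * (xicoef M 2 ?m * ?c 2) * ?m = exp (s * ?c 2 * ?m) - 1"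
    "?m\<^sup>2 * (bcoef M 1 ?m * exp (s * ?c 1 * ?m) + bcoef M 2 ?m * exp (s * ?c 2 * ?m))
      + s * 1 * ?m = exp (s * complex_of_real 1 * ?m) - 1"
    if "s \<in> {1, -1}" for s
    using assms(1)[unfolded fitting_conditions_def I, rule_format, OF that] by (auto simp: mult.assoc I)
  note * = fitting_pair_real_form[OF eqs(1)] fitting_pair_real_form[OF eqs(2)] fitting_pair_real_form[OF eqs(3)]
  show "\<theta>\<^sup>2 * (Re (acoef M 1 1 (mu \<omega> h)) * cos (cnode M 1 * \<omega> * h)) = 1 - cos (cnode M 1 * \<omega> * h)"
    "Re (xicoef M 1 (mu \<omega> h)) * cnode M 1 * \<theta>
      - \<theta>\<^sup>2 * (Re (acoef M 1 1 (mu \<omega> h)) * sin (cnode M 1 * \<omega> * h)) = sin (cnode M 1 * \<omega> * h)"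
    "\<theta>\<^sup>2 * (Re (acoef M 2 1 (mu \<omega> h)) * cos (cnode M 1 * \<omega> * h)
      + Re (acoef M 2 2 (mu \<omega> h)) * cos (cnode M 2 * \<omega> * h)) = 1 - cos (cnode M 2 * \<omega> * h)"
    "Re (xicoef M 2 (mu \<omega> h)) * cnode M 2 * \<theta>
      - \<theta>\<^sup>2 * (Re (acoef M 2 1 (mu \<omega> h)) * sin (cnode M 1 * \<omega> * h)
      + Re (acoef M 2 2 (mu \<omega> h)) * sin (cnode M 2 * \<omega> * h)) = sin (cnode M 2 * \<omega> * h)"
    "\<theta>\<^sup>2 * (Re (bcoef M 1 (mu \<omega> h)) * cos (cnode M 1 * \<omega> * h)
      + Re (bcoef M 2 (mu \<omega> h)) * cos (cnode M 2 * \<omega> * h)) = 1 - cos \<theta>"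
    "\<theta>\<^sup>2 * (Re (bcoef M 1 (mu \<omega> h)) * sin (cnode M 1 * \<omega> * h)
      + Re (bcoef M 2 (mu \<omega> h)) * sin (cnode M 2 * \<omega> * h)) = \<theta> - sin \<theta>"
    using * by (simp_all add: \<theta>_def)
qed

section \<open>Asymptotics of fitted coefficients\<close>

text \<open>Here \<open>x\<close> is xi times the node, and \<open>\<phi> = 0\<close> gives the
  first stage. Dividing the cosine equation by \<open>(\<omega> * h)^2\<close> yields a
  cosine-weighted sum near \<open>c^2 / 2\<close>; the cosine in front of \<open>a\<close> tends to
  1, so \<open>a\<close> is bounded, and then all cosines may be replaced by 1 at the cost of
  O(h^2).\<close>

lemma stage_coefficients_asymptotics:
  fixes a x :: "real \<Rightarrow> real"
  assumes "\<omega> > 0"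
    and cos_eq: "\<forall>\<^sub>F h in at 0. (\<omega> * h)\<^sup>2 * (\<phi> * cos (d * \<omega> * h) + a h * cos (c * \<omega> * h)) = 1 - cos (c * \<omega> * h)"
    and sin_eq: "\<forall>\<^sub>F h in at 0. x h * (\<omega> * h)
      - (\<omega> * h)\<^sup>2 * (\<phi> * sin (d * \<omega> * h) + a h * sin (c * \<omega> * h)) = sin (c * \<omega> * h)"
  shows "vanishes_to 0 a" and "vanishes_to 2 (\<lambda>h. \<phi> + a h - c\<^sup>2 / 2)" and "vanishes_to 2 (\<lambda>h. x h - c)"
proof -
  let ?U = "\<lambda>h. \<phi> * cos (d * \<omega> * h) + a h * cos (c * \<omega> * h) - c\<^sup>2 / 2"
  have U: "vanishes_to 2 ?U"
  proof (rule vanishes_to_cancel[of 4 2])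
    show "vanishes_to 4 (\<lambda>h. h\<^sup>2 *\<^sub>R ?U h)"
    proof (rule vanishes_to_cong)
      show "vanishes_to 4 (\<lambda>h. - inverse (\<omega>\<^sup>2) * (cos (c * \<omega> * h) - 1 + (c * \<omega> * h)\<^sup>2 / 2))"
        by (intro vanishes_to_cmult vanishes_to_trig)
      show "\<forall>\<^sub>F h in at 0. h\<^sup>2 *\<^sub>R ?U h = - inverse (\<omega>\<^sup>2) * (cos (c * \<omega> * h) - 1 + (c * \<omega> * h)\<^sup>2 / 2)"
        using cos_eq
      proof eventually_elim
        case (elim h)
        then have "cos (c * \<omega> * h) - 1 = - (\<omega> * h)\<^sup>2 * (\<phi> * cos (d * \<omega> * h) + a h * cos (c * \<omega> * h))"
          by simp
        then show ?case using assms(1) by (simp only:) (simp add: field_simps)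
      qed
    qed
  qed simp
  have "vanishes_to 0 (\<lambda>h. ?U h + c\<^sup>2 / 2 - \<phi> * cos (d * \<omega> * h))"
    by (intro vanishes_to_diff vanishes_to_add vanishes_to_const vanishes_to_cmult
        vanishes_to_trig vanishes_to_mono[OF U]) simp
  then have "vanishes_to 0 (\<lambda>h. a h * cos (c * \<omega> * h))" by simp
  moreover have "((\<lambda>h. cos (c * \<omega> * h)) \<longlongrightarrow> cos (c * \<omega> * 0)) (at 0)"
    by (intro tendsto_intros)
  ultimately show a: "vanishes_to 0 a"
    by (rule vanishes_to_cancel_limit) simp
  have "vanishes_to 2 (\<lambda>h. ?U h - \<phi> * (cos (d * \<omega> * h) - 1) - a h * (cos (c * \<omega> * h) - 1))"
    by (intro vanishes_to_diff[OF vanishes_to_diff] U vanishes_to_cmult vanishes_to_bounded_mult[OF a]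
        vanishes_to_trig)
  then show "vanishes_to 2 (\<lambda>h. \<phi> + a h - c\<^sup>2 / 2)" by (simp add: algebra_simps)
  show "vanishes_to 2 (\<lambda>h. x h - c)"
  proof (rule vanishes_to_cancel[of 3 1])
    \<comment> \<open>The sine sum is O(h) and carries the factor \<open>h^2\<close>, so it
      contributes O(h^3), like the remainder of the sine on the right-hand side.\<close>
    have S: "vanishes_to 1 (\<lambda>h. \<phi> * sin (d * \<omega> * h) + a h * sin (c * \<omega> * h))"
      by (intro vanishes_to_add vanishes_to_cmult vanishes_to_bounded_mult[OF a] vanishes_to_trig)
    show "vanishes_to 3 (\<lambda>h. h ^ 1 *\<^sub>R (x h - c))"
    proof (rule vanishes_to_cong)
      have "vanishes_to 3 (\<lambda>h. \<omega> * (h\<^sup>2 * (\<phi> * sin (d * \<omega> * h) + a h * sin (c * \<omega> * h))))"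
        using vanishes_to_mult[OF vanishes_to_power[of 2] S] by (intro vanishes_to_cmult) simp
      then show "vanishes_to 3 (\<lambda>h. inverse \<omega> * (sin (c * \<omega> * h) - c * \<omega> * h)
          + \<omega> * (h\<^sup>2 * (\<phi> * sin (d * \<omega> * h) + a h * sin (c * \<omega> * h))))"
        by (intro vanishes_to_add[OF vanishes_to_cmult[OF vanishes_to_trig(4)]])
      show "\<forall>\<^sub>F h in at 0. h ^ 1 *\<^sub>R (x h - c) = inverse \<omega> * (sin (c * \<omega> * h) - c * \<omega> * h)
          + \<omega> * (h\<^sup>2 * (\<phi> * sin (d * \<omega> * h) + a h * sin (c * \<omega> * h)))"
        using sin_eq
      proof eventually_elim
        case (elim h)
        let ?W = "\<phi> * sin (d * \<omega> * h) + a h * sin (c * \<omega> * h)"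
        have "inverse \<omega> * (sin (c * \<omega> * h) - c * \<omega> * h) + \<omega> * (h\<^sup>2 * ?W)
            = inverse \<omega> * (x h * (\<omega> * h) - (\<omega> * h)\<^sup>2 * ?W - c * \<omega> * h) + \<omega> * (h\<^sup>2 * ?W)"
          by (subst elim[symmetric]) simp
        also have "\<dots> = h ^ 1 *\<^sub>R (x h - c)"
          using assms(1) by (simp add: field_simps power2_eq_square)
        finally show ?case by simp
      qed
    qed
  qed simp
qed

lemma tendsto_sin_over_self: "((\<lambda>h. sin (c * h) / h) \<longlongrightarrow> c) (at (0::real))"
proof -
  have "((\<lambda>h. sin (c * h)) has_real_derivative c) (at 0)"
    by (auto intro!: derivative_eq_intros)
  then show ?thesis by (simp add: DERIV_def)
qed

text \<open>The constants 1/2, 1/6 and 1/12 are the integrals of (1 - t) t^k over [0, 1] for k = 0,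
  1, 2. The fitting equations give the first two moments; the node condition gives the
  third.\<close>

lemma quadrature_weights_asymptotics:
  fixes b1 b2 :: "real \<Rightarrow> real"
  assumes "\<omega> > 0" "c1 \<noteq> c2" and nodes: "2 * (c1 + c2 - 3 * c1 * c2) - 1 = 0"
    and cos_eq: "\<forall>\<^sub>F h in at 0. (\<omega> * h)\<^sup>2 * (b1 h * cos (c1 * \<omega> * h) + b2 h * cos (c2 * \<omega> * h)) = 1 - cos (\<omega> * h)"
    and sin_eq: "\<forall>\<^sub>F h in at 0. (\<omega> * h)\<^sup>2 * (b1 h * sin (c1 * \<omega> * h) + b2 h * sin (c2 * \<omega> * h)) = \<omega> * h - sin (\<omega> * h)"
  shows "vanishes_to 0 b1" and "vanishes_to 0 b2"
    and "vanishes_to 4 (\<lambda>h. b1 h + b2 h - 1 / 2)"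
    and "vanishes_to 2 (\<lambda>h. b1 h * c1 + b2 h * c2 - 1 / 6)"
    and "vanishes_to 2 (\<lambda>h. b1 h * c1\<^sup>2 + b2 h * c2\<^sup>2 - 1 / 12)"
proof -
  define C where "C h = b1 h * cos (c1 * \<omega> * h) + b2 h * cos (c2 * \<omega> * h)" for h
  define S where "S h = b1 h * sin (c1 * \<omega> * h) + b2 h * sin (c2 * \<omega> * h)" for h
  note mono = vanishes_to_mono
  \<comment> \<open>With x = \<open>\<omega> * h\<close>, dividing 1 - cos x = x^2/2 - x^4/24 +
    O(x^6) by x^2 leaves 1/2 - x^2/24.\<close>
  have C4: "vanishes_to 4 (\<lambda>h. C h - 1 / 2 + (\<omega> * h)\<^sup>2 / 24)"
  proof (rule vanishes_to_cancel[of 6 2])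
    show "vanishes_to 6 (\<lambda>h. h\<^sup>2 *\<^sub>R (C h - 1 / 2 + (\<omega> * h)\<^sup>2 / 24))"
    proof (rule vanishes_to_cong)
      show "vanishes_to 6 (\<lambda>h. - inverse (\<omega>\<^sup>2) * (cos (\<omega> * h) - 1 + (\<omega> * h)\<^sup>2 / 2 - (\<omega> * h) ^ 4 / 24))"
        by (intro vanishes_to_cmult vanishes_to_trig)
      show "\<forall>\<^sub>F h in at 0. h\<^sup>2 *\<^sub>R (C h - 1 / 2 + (\<omega> * h)\<^sup>2 / 24)
          = - inverse (\<omega>\<^sup>2) * (cos (\<omega> * h) - 1 + (\<omega> * h)\<^sup>2 / 2 - (\<omega> * h) ^ 4 / 24)"
        using cos_eq
      proof eventually_elim
        case (elim h)
        then have "cos (\<omega> * h) = 1 - (\<omega> * h)\<^sup>2 * C h" by (simp add: C_def)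
        then show ?case using assms(1) by (simp only:) (simp add: field_simps eval_nat_numeral)
      qed
    qed
  qed simp
  \<comment> \<open>Likewise x - sin x = x^3/6 + O(x^5), divided by x^2.\<close>
  have S3: "vanishes_to 3 (\<lambda>h. S h - \<omega> * h / 6)"
  proof (rule vanishes_to_cancel[of 5 2])
    show "vanishes_to 5 (\<lambda>h. h\<^sup>2 *\<^sub>R (S h - \<omega> * h / 6))"
    proof (rule vanishes_to_cong)
      show "vanishes_to 5 (\<lambda>h. - inverse (\<omega>\<^sup>2) * (sin (\<omega> * h) - \<omega> * h + (\<omega> * h) ^ 3 / 6))"
        by (intro vanishes_to_cmult vanishes_to_trig)
      show "\<forall>\<^sub>F h in at 0. h\<^sup>2 *\<^sub>R (S h - \<omega> * h / 6)
          = - inverse (\<omega>\<^sup>2) * (sin (\<omega> * h) - \<omega> * h + (\<omega> * h) ^ 3 / 6)"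
        using sin_eq
      proof eventually_elim
        case (elim h)
        then have "sin (\<omega> * h) = \<omega> * h - (\<omega> * h)\<^sup>2 * S h" by (simp add: S_def)
        then show ?case using assms(1) by (simp only:) (simp add: field_simps eval_nat_numeral)
      qed
    qed
  qed simp
  have h: "vanishes_to 1 (\<lambda>h. h :: real)" using vanishes_to_power[of 1] by simp
  have h2: "vanishes_to 2 (\<lambda>h. (\<omega> * h)\<^sup>2 / 24)"
    using vanishes_to_cmult[OF vanishes_to_power[of 2], of "\<omega>\<^sup>2 / 24"] by (simp add: power_mult_distrib)
  have C2: "vanishes_to 2 (\<lambda>h. C h - 1 / 2)"
    using vanishes_to_diff[OF mono[OF C4, of 2] h2] by simp
  have C0: "vanishes_to 0 C"
    using vanishes_to_add[OF mono[OF C2, of 0] vanishes_to_const[of "1 / 2"]] by simp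
  have S1: "vanishes_to 1 S"
    using vanishes_to_add[OF mono[OF S3, of 1] vanishes_to_cmult[OF h, of "\<omega> / 6"]] by simp
  \<comment> \<open>Cramer's rule: the determinant \<open>sin ((c2 - c1) \<omega> h)\<close> vanishes to first order only.\<close>
  have det: "vanishes_to 0 b" if "vanishes_to 1 (\<lambda>h. b h * sin ((c2 - c1) * \<omega> * h))" for b :: "real \<Rightarrow> real"
  proof (rule vanishes_to_cancel_limit)
    have "vanishes_to 1 (\<lambda>h. h ^ 1 *\<^sub>R (b h * (sin ((c2 - c1) * \<omega> * h) / h)))"
      by (rule vanishes_to_cong[OF _ that]) (simp add: eventually_at_filter)
    then show "vanishes_to 0 (\<lambda>h. b h * (sin ((c2 - c1) * \<omega> * h) / h))"
      by (rule vanishes_to_cancel) simp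
    show "((\<lambda>h. sin ((c2 - c1) * \<omega> * h) / h) \<longlongrightarrow> (c2 - c1) * \<omega>) (at 0)"
      by (rule tendsto_sin_over_self)
    show "(c2 - c1) * \<omega> \<noteq> 0" using assms(1,2) by simp
  qed
  have angle: "(c2 - c1) * \<omega> * h = c2 * \<omega> * h - c1 * \<omega> * h" for h by (simp add: algebra_simps)
  \<comment> \<open>For \<open>c = c2\<close> this combination is \<open>b1 h\<close> times the
    determinant, for \<open>c = c1\<close> it is the negative of \<open>b2 h\<close> times
    it.\<close>
  have "vanishes_to 1 (\<lambda>h. C h * sin (c * \<omega> * h) - S h * cos (c * \<omega> * h))" for c
    using vanishes_to_bounded_mult[OF C0 vanishes_to_trig(2)] vanishes_to_mult[OF S1 vanishes_to_trig(1)]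
    by (intro vanishes_to_diff) simp_all
  note this[of c2] vanishes_to_minus[OF this[of c1]]
  then have "vanishes_to 1 (\<lambda>h. b1 h * sin ((c2 - c1) * \<omega> * h))"
    "vanishes_to 1 (\<lambda>h. b2 h * sin ((c2 - c1) * \<omega> * h))"
    unfolding angle by (simp_all add: C_def S_def sin_diff algebra_simps)
  note b = this[THEN det]
  then show "vanishes_to 0 b1" "vanishes_to 0 b2" .
  have "vanishes_to 2 (\<lambda>h. b1 h * (cos (c1 * \<omega> * h) - 1))" "vanishes_to 2 (\<lambda>h. b2 h * (cos (c2 * \<omega> * h) - 1))"
    by (intro vanishes_to_bounded_mult b vanishes_to_trig)+
  with C2 have "vanishes_to 2 (\<lambda>h. C h - 1 / 2 - b1 h * (cos (c1 * \<omega> * h) - 1) - b2 h * (cos (c2 * \<omega> * h) - 1))"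
    by (intro vanishes_to_diff[OF vanishes_to_diff])
  then have sum0: "vanishes_to 2 (\<lambda>h. b1 h + b2 h - 1 / 2)" by (simp add: C_def algebra_simps)
  show sum1: "vanishes_to 2 (\<lambda>h. b1 h * c1 + b2 h * c2 - 1 / 6)"
  proof (rule vanishes_to_cancel[of 3 1])
    have "vanishes_to 3 (\<lambda>h. b1 h * (sin (c1 * \<omega> * h) - c1 * \<omega> * h))"
      "vanishes_to 3 (\<lambda>h. b2 h * (sin (c2 * \<omega> * h) - c2 * \<omega> * h))"
      by (intro vanishes_to_bounded_mult b vanishes_to_trig)+
    with S3 have "vanishes_to 3 (\<lambda>h. inverse \<omega> * (S h - \<omega> * h / 6 - b1 h * (sin (c1 * \<omega> * h) - c1 * \<omega> * h)
        - b2 h * (sin (c2 * \<omega> * h) - c2 * \<omega> * h)))"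
      by (intro vanishes_to_cmult vanishes_to_diff[OF vanishes_to_diff])
    moreover have "h ^ 1 *\<^sub>R (b1 h * c1 + b2 h * c2 - 1 / 6)
        = inverse \<omega> * (S h - \<omega> * h / 6 - b1 h * (sin (c1 * \<omega> * h) - c1 * \<omega> * h)
        - b2 h * (sin (c2 * \<omega> * h) - c2 * \<omega> * h))" for h
      using assms(1) by (simp add: S_def field_simps)
    ultimately show "vanishes_to 3 (\<lambda>h. h ^ 1 *\<^sub>R (b1 h * c1 + b2 h * c2 - 1 / 6))"
      by (simp only:)
  qed simp
  \<comment> \<open>Both nodes are roots of t^2 - (c1 + c2) t + c1 c2, and the node condition is
    exactly 1/12 = (c1 + c2)/6 - c1 c2/2.\<close>
  have "b1 h * c1\<^sup>2 + b2 h * c2\<^sup>2 - 1 / 12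
      = (c1 + c2) * (b1 h * c1 + b2 h * c2 - 1 / 6) - c1 * c2 * (b1 h + b2 h - 1 / 2)" for h
    using nodes by algebra
  then show sum2: "vanishes_to 2 (\<lambda>h. b1 h * c1\<^sup>2 + b2 h * c2\<^sup>2 - 1 / 12)"
    using vanishes_to_diff[OF vanishes_to_cmult[OF sum1, of "c1 + c2"] vanishes_to_cmult[OF sum0, of "c1 * c2"]]
    by simp
  \<comment> \<open>With the cosines in \<open>C\<close> expanded one term further, their quadratic
    parts add up, by \<open>sum2\<close>, to minus \<open>(\<omega> * h)^2 / 24\<close> up to
    O(h^4), and this cancels against the term in \<open>C4\<close>. The rate of \<open>sum0\<close>
    thus rises from 2 to 4.\<close>
  have "vanishes_to 4 (\<lambda>h. b1 h * (cos (c1 * \<omega> * h) - 1 + (c1 * \<omega> * h)\<^sup>2 / 2))"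
    "vanishes_to 4 (\<lambda>h. b2 h * (cos (c2 * \<omega> * h) - 1 + (c2 * \<omega> * h)\<^sup>2 / 2))"
    by (intro vanishes_to_bounded_mult b vanishes_to_trig)+
  moreover have "vanishes_to 4 (\<lambda>h. \<omega>\<^sup>2 / 2 * (h\<^sup>2 * (b1 h * c1\<^sup>2 + b2 h * c2\<^sup>2 - 1 / 12)))"
    using vanishes_to_mult[OF vanishes_to_power[of 2] sum2] by (intro vanishes_to_cmult) simp
  ultimately have "vanishes_to 4 (\<lambda>h. C h - 1 / 2 + (\<omega> * h)\<^sup>2 / 24
      - b1 h * (cos (c1 * \<omega> * h) - 1 + (c1 * \<omega> * h)\<^sup>2 / 2)
      - b2 h * (cos (c2 * \<omega> * h) - 1 + (c2 * \<omega> * h)\<^sup>2 / 2)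
      + \<omega>\<^sup>2 / 2 * (h\<^sup>2 * (b1 h * c1\<^sup>2 + b2 h * c2\<^sup>2 - 1 / 12)))"
    by (intro vanishes_to_add[OF vanishes_to_diff[OF vanishes_to_diff[OF C4]]])
  also have "(\<lambda>h. C h - 1 / 2 + (\<omega> * h)\<^sup>2 / 24
      - b1 h * (cos (c1 * \<omega> * h) - 1 + (c1 * \<omega> * h)\<^sup>2 / 2)
      - b2 h * (cos (c2 * \<omega> * h) - 1 + (c2 * \<omega> * h)\<^sup>2 / 2)
      + \<omega>\<^sup>2 / 2 * (h\<^sup>2 * (b1 h * c1\<^sup>2 + b2 h * c2\<^sup>2 - 1 / 12))) = (\<lambda>h. b1 h + b2 h - 1 / 2)"
    by (rule ext) (simp add: C_def field_simps)
  finally show "vanishes_to 4 (\<lambda>h. b1 h + b2 h - 1 / 2)" .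
qed

section \<open>Consistency\<close>

lemma second_deriv_field_eq_lie_derivative: "second_deriv_field f = lie_derivative f f"
  by (simp add: fun_eq_iff second_deriv_field_def lie_derivative_def)

lemma stage_equations_iff:
  "stage_equations M \<omega> f yn h Y \<longleftrightarrow>
     Y 1 = yn + (Re (xicoef M 1 (mu \<omega> h)) * cnode M 1 * h) *\<^sub>R f yn
       + (h\<^sup>2 * Re (acoef M 1 1 (mu \<omega> h))) *\<^sub>R second_deriv_field f (Y 1)
   \<and> Y 2 = yn + (Re (xicoef M 2 (mu \<omega> h)) * cnode M 2 * h) *\<^sub>R f yn
       + h\<^sup>2 *\<^sub>R Re (acoef M 2 1 (mu \<omega> h)) *\<^sub>R second_deriv_field f (Y 1)
       + (h\<^sup>2 * Re (acoef M 2 2 (mu \<omega> h))) *\<^sub>R second_deriv_field f (Y 2)"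
proof -
  have I: "{1..2::nat} = {1, 2}" "{1..1::nat} = {1}" "{Suc 0..2} = {1, 2}" by auto
  have "(1::nat) \<noteq> 2" by simp
  then show ?thesis
    unfolding stage_equations_def I by (simp add: I add.assoc scaleR_right_distrib)
qed

text \<open>Reflects the triangular form of the stage equations: the first stage is solved alone,
  the second with the first as a parameter.\<close>

lemma ex1_pair_in_PiE:
  assumes ex1: "\<exists>!z. z \<in> S \<and> P z" and ex2: "\<And>z. z \<in> S \<Longrightarrow> \<exists>!w. w \<in> S \<and> Q z w"
  shows "\<exists>!Y. Y \<in> {1..2::nat} \<rightarrow>\<^sub>E S \<and> P (Y 1) \<and> Q (Y 1) (Y 2)"
proof -
  have I: "{1..2::nat} = {1, 2}" by auto
  obtain z where z: "z \<in> S" "P z" using ex1 by blast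
  obtain w where w: "w \<in> S" "Q z w" using ex2[OF z(1)] by blast
  show ?thesis
  proof (rule ex1I)
    show "(\<lambda>i\<in>{1..2}. if i = 1 then z else w) \<in> {1..2::nat} \<rightarrow>\<^sub>E S
        \<and> P ((\<lambda>i\<in>{1..2}. if i = 1 then z else w) (1::nat))
        \<and> Q ((\<lambda>i\<in>{1..2}. if i = 1 then z else w) (1::nat)) ((\<lambda>i\<in>{1..2}. if i = 1 then z else w) (2::nat))"
      using z w by auto
  next
    fix Y assume Y: "Y \<in> {1..2::nat} \<rightarrow>\<^sub>E S \<and> P (Y 1) \<and> Q (Y 1) (Y 2)"
    then have S: "Y 1 \<in> S" "Y 2 \<in> S" by (auto simp: PiE_def Pi_def)
    then have Y1: "Y 1 = z" using Y ex1 z by blast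
    then have Y2: "Y 2 = w" using Y S ex2[OF z(1)] w by blast
    show "Y = (\<lambda>i\<in>{1..2}. if i = 1 then z else w)"
    proof (rule PiE_ext[of Y "{1..2}" "\<lambda>_. S"])
      show "Y \<in> {1..2} \<rightarrow>\<^sub>E S" using Y by blast
      show "(\<lambda>i\<in>{1..2}. if i = 1 then z else w) \<in> {1..2} \<rightarrow>\<^sub>E S" using z w by auto
      show "Y i = (\<lambda>i\<in>{1..2}. if i = 1 then z else w) i" if "i \<in> {1..2}" for i
        using that Y1 Y2 unfolding I by auto
    qed
  qed
qed

section \<open>Expansion of the stages and of the solution\<close>

text \<open>Serves both stages: \<open>u\<close> is the stage in question, \<open>v\<close> the
  earlier one. On the ball \<open>g\<close> is bounded, so the equation gives
  \<open>u - y0 = O(h)\<close>; the Lipschitz bound then replaces \<open>g\<close> at the stages by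
  \<open>g y0\<close> up to O(h), which the factor \<open>h^2\<close> turns into O(h^3).\<close>

lemma stage_expansion:
  fixes g :: "'a::euclidean_space \<Rightarrow> 'a"
  assumes "r > 0"
    and lip: "\<And>x z. x \<in> cball y0 r \<Longrightarrow> z \<in> cball y0 r \<Longrightarrow> norm (g x - g z) \<le> L * norm (x - z)"
    and u: "\<forall>\<^sub>F h in at 0. u h \<in> ball y0 r" and v: "\<forall>\<^sub>F h in at 0. v h \<in> ball y0 r"
    and v1: "vanishes_to 1 (\<lambda>h. v h - y0)"
    and eq: "\<forall>\<^sub>F h in at 0. u h = y0 + (x h * h) *\<^sub>R f0 + h\<^sup>2 *\<^sub>R (\<phi> h *\<^sub>R g (v h) + a h *\<^sub>R g (u h))"
    and \<phi>: "vanishes_to 0 \<phi>" and a: "vanishes_to 0 a" and x: "vanishes_to 2 (\<lambda>h. x h - c)"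
    and \<phi>a: "vanishes_to 1 (\<lambda>h. \<phi> h + a h - c\<^sup>2 / 2)"
  shows "vanishes_to 1 (\<lambda>h. u h - y0)"
    and "vanishes_to 3 (\<lambda>h. u h - (y0 + (c * h) *\<^sub>R f0 + (c\<^sup>2 * h\<^sup>2 / 2) *\<^sub>R g y0))"
proof -
  have h1: "vanishes_to 1 (\<lambda>h. h :: real)" using vanishes_to_power[of 1] by simp
  have g_lip: "\<forall>\<^sub>F h in at 0. norm (g (w h) - g y0) \<le> L * norm (w h - y0)"
    if "\<forall>\<^sub>F h in at 0. w h \<in> ball y0 r" for w
    using that by eventually_elim (use lip \<open>r > 0\<close> in auto)
  have g_bounded: "vanishes_to 0 (\<lambda>h. g (w h))" if w: "\<forall>\<^sub>F h in at 0. w h \<in> ball y0 r" for w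
  proof (rule vanishes_toI[of _ "norm (g y0) + \<bar>L\<bar> * r"])
    show "\<forall>\<^sub>F h in at 0. norm (g (w h)) \<le> (norm (g y0) + \<bar>L\<bar> * r) * \<bar>h\<bar> ^ 0"
      using w g_lip[OF w]
    proof eventually_elim
      case (elim h)
      have "norm (w h - y0) \<le> r" using elim(1) by (simp add: dist_norm norm_minus_commute)
      then have "L * norm (w h - y0) \<le> \<bar>L\<bar> * r" by (intro mult_mono) auto
      then show ?case using elim(2) norm_triangle_sub[of "g (w h)" "g y0"] by simp
    qed
  qed
  have x0: "vanishes_to 0 x"
    using vanishes_to_add[OF vanishes_to_mono[OF x, of 0] vanishes_to_const[of c]] by simp
  show u1: "vanishes_to 1 (\<lambda>h. u h - y0)"
  proof (rule vanishes_to_cong)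
    have "vanishes_to 1 (\<lambda>h. (x h * h) *\<^sub>R f0)"
      using vanishes_to_scaleR[OF vanishes_to_bounded_mult[OF x0 h1] vanishes_to_const] by simp
    moreover have "vanishes_to 2 (\<lambda>h. h\<^sup>2 *\<^sub>R (\<phi> h *\<^sub>R g (v h) + a h *\<^sub>R g (u h)))"
      using vanishes_to_scaleR[OF vanishes_to_power[of 2] vanishes_to_add[OF
          vanishes_to_bounded_scaleR[OF \<phi> g_bounded[OF v]]
          vanishes_to_bounded_scaleR[OF a g_bounded[OF u]]]] by simp
    ultimately show "vanishes_to 1 (\<lambda>h. (x h * h) *\<^sub>R f0 + h\<^sup>2 *\<^sub>R (\<phi> h *\<^sub>R g (v h) + a h *\<^sub>R g (u h)))"
      by (intro vanishes_to_add) (auto elim: vanishes_to_mono)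
    show "\<forall>\<^sub>F h in at 0. u h - y0 = (x h * h) *\<^sub>R f0 + h\<^sup>2 *\<^sub>R (\<phi> h *\<^sub>R g (v h) + a h *\<^sub>R g (u h))"
      using eq by eventually_elim (simp only: diff_eq_eq, simp only: ac_simps)
  qed
  show "vanishes_to 3 (\<lambda>h. u h - (y0 + (c * h) *\<^sub>R f0 + (c\<^sup>2 * h\<^sup>2 / 2) *\<^sub>R g y0))"
  proof (rule vanishes_to_cong)
    have "vanishes_to 3 (\<lambda>h. ((x h - c) * h) *\<^sub>R f0)"
      using vanishes_to_scaleR[OF vanishes_to_mult[OF x h1] vanishes_to_const] by simp
    moreover have "vanishes_to 1 (\<lambda>h. \<phi> h *\<^sub>R (g (v h) - g y0) + a h *\<^sub>R (g (u h) - g y0)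
        + (\<phi> h + a h - c\<^sup>2 / 2) *\<^sub>R g y0)"
      using vanishes_to_scaleR[OF \<phi>a vanishes_to_const[of "g y0"]]
      by (intro vanishes_to_add vanishes_to_bounded_scaleR[OF \<phi>] vanishes_to_bounded_scaleR[OF a]
          vanishes_to_lipschitz[OF v1 g_lip[OF v]] vanishes_to_lipschitz[OF u1 g_lip[OF u]]) simp
    then have "vanishes_to 3 (\<lambda>h. h\<^sup>2 *\<^sub>R (\<phi> h *\<^sub>R (g (v h) - g y0) + a h *\<^sub>R (g (u h) - g y0)
        + (\<phi> h + a h - c\<^sup>2 / 2) *\<^sub>R g y0))"
      using vanishes_to_scaleR[OF vanishes_to_power[of 2]] by fastforce
    ultimately show "vanishes_to 3 (\<lambda>h. ((x h - c) * h) *\<^sub>R f0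
        + h\<^sup>2 *\<^sub>R (\<phi> h *\<^sub>R (g (v h) - g y0) + a h *\<^sub>R (g (u h) - g y0)
        + (\<phi> h + a h - c\<^sup>2 / 2) *\<^sub>R g y0))"
      by (rule vanishes_to_add)
    show "\<forall>\<^sub>F h in at 0. u h - (y0 + (c * h) *\<^sub>R f0 + (c\<^sup>2 * h\<^sup>2 / 2) *\<^sub>R g y0)
        = ((x h - c) * h) *\<^sub>R f0
        + h\<^sup>2 *\<^sub>R (\<phi> h *\<^sub>R (g (v h) - g y0) + a h *\<^sub>R (g (u h) - g y0)
        + (\<phi> h + a h - c\<^sup>2 / 2) *\<^sub>R g y0)"
      using eq
    proof eventually_elim
      case (elim h)
      show ?case
        by (rule euclidean_eqI, subst (1) elim) (simp add: inner_simps algebra_simps)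
    qed
  qed
qed

text \<open>A field of class \<open>p\<close> has solutions with \<open>p + 1\<close> continuous
  derivatives, whence \<open>l + n <= Suc p\<close>. The start index \<open>l\<close> selects what
  is expanded: \<open>l = 0\<close> the solution, \<open>l = 2\<close> the field g along it.\<close>

lemma local_solution_Taylor:
  fixes f :: "'a::euclidean_space \<Rightarrow> 'a"
  assumes "open U" "C_on p f U" "local_solution f U y x0"
  defines "D \<equiv> \<lambda>m h. case m of 0 \<Rightarrow> y (x0 + h) | Suc k \<Rightarrow> (lie_derivative f ^^ k) f (y (x0 + h))"
  assumes "l + n \<le> Suc p"
  shows "vanishes_to n (\<lambda>h. D l (c * h) - (\<Sum>m<n. (h ^ m / fact m) *\<^sub>R c ^ m *\<^sub>R D (l + m) 0))"
proof -
  obtain T where "T > 0" and T: "\<And>t. \<bar>t - x0\<bar> < T \<Longrightarrow> y t \<in> U"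
    "\<And>t. \<bar>t - x0\<bar> < T \<Longrightarrow> (y has_vector_derivative f (y t)) (at t)"
    using assms(3) unfolding local_solution_def by blast
  have y: "((\<lambda>h. y (x0 + h)) has_vector_derivative f (y (x0 + h))) (at h)" if "\<bar>h\<bar> < T" for h
  proof -
    have "((\<lambda>h. x0 + h) has_vector_derivative 1) (at h)"
      by (auto intro!: derivative_eq_intros simp: has_real_derivative_iff_has_vector_derivative[symmetric])
    from vector_diff_chain_at[OF this T(2)[of "x0 + h"]] that show ?thesis by (simp add: o_def)
  qed
  have D: "(D m has_vector_derivative D (Suc m) h) (at h)" if "m \<le> p" "\<bar>h\<bar> < T" for m h
  proof (cases m)
    case 0
    then show ?thesis using y[OF that(2)] by (simp add: D_def)
  next
    case (Suc k)
    have "C_on (Suc (p - Suc k)) ((lie_derivative f ^^ k) f) U"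
      using C_on_lie_derivative_funpow[OF assms(1,2), of k] that(1) Suc
      by (simp del: C_on.simps add: Suc_diff_Suc)
    from has_vector_derivative_along_solution[OF this, of "\<lambda>h. y (x0 + h)" h f] T(1)[of "x0 + h"] y[OF that(2)]
    show ?thesis using that(2) by (simp add: D_def Suc)
  qed
  have cont: "isCont (D m) 0" if "m \<le> Suc p" for m
  proof (cases m)
    case 0
    then show ?thesis using D[of 0 0] \<open>T > 0\<close> has_vector_derivative_continuous by auto
  next
    case (Suc k)
    have "isCont (\<lambda>h. y (x0 + h)) 0"
      using y[of 0] \<open>T > 0\<close> has_vector_derivative_continuous by auto
    moreover have "continuous_on U ((lie_derivative f ^^ k) f)"
      using C_on_lie_derivative_funpow[OF assms(1,2), of k] that Suc by (intro C_on_continuous) auto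
    then have "isCont ((lie_derivative f ^^ k) f) (y (x0 + 0))"
      using T(1)[of x0] \<open>T > 0\<close> assms(1) by (simp add: continuous_on_eq_continuous_at)
    ultimately have "isCont (\<lambda>h. (lie_derivative f ^^ k) f (y (x0 + h))) 0"
      by (rule isCont_o2)
    then show ?thesis by (simp add: D_def Suc)
  qed
  have ev: "\<forall>\<^sub>F h in nhds (0::real). \<bar>h\<bar> < T"
    unfolding eventually_nhds_metric using \<open>T > 0\<close> by (auto simp: dist_real_def)
  have "vanishes_to n (\<lambda>h. D (l + 0) (c * h) - (\<Sum>m<n. (h ^ m / fact m) *\<^sub>R c ^ m *\<^sub>R D (l + m) 0))"
  proof (rule vanishes_to_Taylor_scaled[of n "\<lambda>m. D (l + m)"])
    fix m assume "m < n"
    show "\<forall>\<^sub>F h in nhds 0. (D (l + m) has_vector_derivative D (l + Suc m) h) (at h)"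
      using ev by eventually_elim (use D[of "l + m"] \<open>m < n\<close> assms(5) in simp)
  qed (use cont[of "l + n"] assms(5) in simp)
  then show ?thesis by simp
qed

text \<open>All coefficients carry a factor \<open>h\<close> or \<open>h^2\<close>, so for small
  \<open>h\<close> both implicit equations are contractions that keep the ball inside
  itself.\<close>

lemma stages_exist_unique:
  fixes f :: "'a::euclidean_space \<Rightarrow> 'a"
  assumes "r > 0"
    and lip: "\<And>x z. x \<in> cball y0 r \<Longrightarrow> z \<in> cball y0 r \<Longrightarrow>
      norm (second_deriv_field f x - second_deriv_field f z) \<le> L * norm (x - z)"
    and a11: "vanishes_to 0 (\<lambda>h. Re (acoef M 1 1 (mu \<omega> h)))"
    and a21: "vanishes_to 0 (\<lambda>h. Re (acoef M 2 1 (mu \<omega> h)))"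
    and a22: "vanishes_to 0 (\<lambda>h. Re (acoef M 2 2 (mu \<omega> h)))"
    and x1: "vanishes_to 0 (\<lambda>h. Re (xicoef M 1 (mu \<omega> h)) * cnode M 1)"
    and x2: "vanishes_to 0 (\<lambda>h. Re (xicoef M 2 (mu \<omega> h)) * cnode M 2)"
  shows "\<forall>\<^sub>F h in at 0. \<exists>!Y. Y \<in> {1..2} \<rightarrow>\<^sub>E ball y0 r \<and> stage_equations M \<omega> f y0 h Y"
proof -
  let ?g = "second_deriv_field f"
  define B where "B = norm (?g y0) + \<bar>L\<bar> * r"
  have bound: "norm (?g x) \<le> B" if "x \<in> cball y0 r" for x
  proof -
    have "norm (x - y0) \<le> r" using that by (simp add: dist_norm norm_minus_commute)
    then have "L * norm (x - y0) \<le> \<bar>L\<bar> * r" by (intro mult_mono) auto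
    then show ?thesis
      using lip[OF that, of y0] norm_triangle_sub[of "?g x" "?g y0"] \<open>r > 0\<close> by (simp add: B_def)
  qed
  have lim2: "((\<lambda>h. h\<^sup>2 * a h) \<longlongrightarrow> 0) (at 0)" if "vanishes_to 0 a" for a :: "real \<Rightarrow> real"
    using vanishes_to_mult[OF vanishes_to_power[of 2] that] by (intro vanishes_to_imp_tendsto[of 2]) simp_all
  have lim1: "((\<lambda>h. a h * h) \<longlongrightarrow> 0) (at 0)" if "vanishes_to 0 a" for a :: "real \<Rightarrow> real"
    using vanishes_to_mult[OF that vanishes_to_power[of 1]] by (intro vanishes_to_imp_tendsto[of 1]) simp_all
  note lims = lim2[OF a11] lim2[OF a21] lim2[OF a22] lim1[OF x1] lim1[OF x2]
  define A1 where "A1 h = (Re (xicoef M 1 (mu \<omega> h)) * cnode M 1 * h) *\<^sub>R f y0" for h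
  define A2 where "A2 h = (Re (xicoef M 2 (mu \<omega> h)) * cnode M 2 * h) *\<^sub>R f y0" for h
  define \<alpha>11 where "\<alpha>11 h = h\<^sup>2 * Re (acoef M 1 1 (mu \<omega> h))" for h
  define \<alpha>21 where "\<alpha>21 h = h\<^sup>2 * Re (acoef M 2 1 (mu \<omega> h))" for h
  define \<alpha>22 where "\<alpha>22 h = h\<^sup>2 * Re (acoef M 2 2 (mu \<omega> h))" for h
  have "((\<lambda>h. \<bar>\<alpha>11 h\<bar> * L) \<longlongrightarrow> \<bar>0\<bar> * L) (at 0)" "((\<lambda>h. \<bar>\<alpha>22 h\<bar> * L) \<longlongrightarrow> \<bar>0\<bar> * L) (at 0)"
    "((\<lambda>h. norm (A1 h) + \<bar>\<alpha>11 h\<bar> * B) \<longlongrightarrow> norm (0 *\<^sub>R f y0) + \<bar>0\<bar> * B) (at 0)"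
    "((\<lambda>h. norm (A2 h) + \<bar>\<alpha>21 h\<bar> * B + \<bar>\<alpha>22 h\<bar> * B) \<longlongrightarrow> norm (0 *\<^sub>R f y0) + \<bar>0\<bar> * B + \<bar>0\<bar> * B) (at 0)"
    unfolding A1_def A2_def \<alpha>11_def \<alpha>21_def \<alpha>22_def by (intro tendsto_intros lims)+
  then have "\<forall>\<^sub>F h in at 0. \<bar>\<alpha>11 h\<bar> * L < 1" "\<forall>\<^sub>F h in at 0. \<bar>\<alpha>22 h\<bar> * L < 1"
    "\<forall>\<^sub>F h in at 0. norm (A1 h) + \<bar>\<alpha>11 h\<bar> * B < r"
    "\<forall>\<^sub>F h in at 0. norm (A2 h) + \<bar>\<alpha>21 h\<bar> * B + \<bar>\<alpha>22 h\<bar> * B < r"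
    using \<open>r > 0\<close> by (auto elim!: order_tendstoD(2))
  then show ?thesis
  proof eventually_elim
    case (elim h)
    have "\<exists>!Y. Y \<in> {1..2::nat} \<rightarrow>\<^sub>E ball y0 r \<and> Y 1 = (y0 + A1 h) + \<alpha>11 h *\<^sub>R ?g (Y 1)
      \<and> Y 2 = (y0 + A2 h + \<alpha>21 h *\<^sub>R ?g (Y 1)) + \<alpha>22 h *\<^sub>R ?g (Y 2)"
    proof (rule ex1_pair_in_PiE)
      show "\<exists>!z. z \<in> ball y0 r \<and> z = (y0 + A1 h) + \<alpha>11 h *\<^sub>R ?g z"
        using elim by (intro perturbed_fixed_point_in_ball[OF \<open>r > 0\<close> lip bound]) simp_all
      \<comment> \<open>The first stage enters the second equation through a term bounded by
        \<open>B\<close> uniformly in \<open>z\<close>, so one threshold for \<open>h\<close> serves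
        every \<open>z\<close>.\<close>
      fix z assume "z \<in> ball y0 r"
      then have "\<bar>\<alpha>21 h\<bar> * norm (?g z) \<le> \<bar>\<alpha>21 h\<bar> * B"
        using bound ball_subset_cball by (intro mult_left_mono) auto
      then have "norm (y0 + A2 h + \<alpha>21 h *\<^sub>R ?g z - y0) + \<bar>\<alpha>22 h\<bar> * B < r"
        using elim(4) norm_triangle_ineq[of "A2 h" "\<alpha>21 h *\<^sub>R ?g z"] by (simp add: add.assoc)
      then show "\<exists>!w. w \<in> ball y0 r \<and> w = (y0 + A2 h + \<alpha>21 h *\<^sub>R ?g z) + \<alpha>22 h *\<^sub>R ?g w"
        using elim(2) by (intro perturbed_fixed_point_in_ball[OF \<open>r > 0\<close> lip bound])
    qed
    then show ?case
      unfolding stage_equations_iff A1_def A2_def \<alpha>11_def \<alpha>21_def \<alpha>22_def by (simp only: scaleR_scaleR)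
  qed
qed

text \<open>The order conditions with their rates: the defects in \<open>b0\<close>,
  \<open>b1\<close> and \<open>b2\<close> enter the error with the factors \<open>h^2\<close>,
  \<open>h^3\<close> and \<open>h^4\<close>, so the rates 3, 2 and 1 make each contribution
  O(h^5).\<close>

theorem consistency_order_4I:
  fixes M :: tddirk and \<omega> :: real
  defines "a \<equiv> \<lambda>i j h. Re (acoef M i j (mu \<omega> h))"
    and "x \<equiv> \<lambda>i h. Re (xicoef M i (mu \<omega> h)) * cnode M i"
    and "b \<equiv> \<lambda>i h. Re (bcoef M i (mu \<omega> h))" and "c \<equiv> cnode M"
  assumes a11: "vanishes_to 0 (a 1 1)" and a21: "vanishes_to 0 (a 2 1)" and a22: "vanishes_to 0 (a 2 2)"
    and x1: "vanishes_to 2 (\<lambda>h. x 1 h - c 1)" and x2: "vanishes_to 2 (\<lambda>h. x 2 h - c 2)"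
    and a1: "vanishes_to 1 (\<lambda>h. a 1 1 h - (c 1)\<^sup>2 / 2)"
    and a2: "vanishes_to 1 (\<lambda>h. a 2 1 h + a 2 2 h - (c 2)\<^sup>2 / 2)"
    and b: "vanishes_to 0 (b 1)" "vanishes_to 0 (b 2)"
    and b0: "vanishes_to 3 (\<lambda>h. b 1 h + b 2 h - 1 / 2)"
    and b1: "vanishes_to 2 (\<lambda>h. b 1 h * c 1 + b 2 h * c 2 - 1 / 6)"
    and b2: "vanishes_to 1 (\<lambda>h. b 1 h * (c 1)\<^sup>2 + b 2 h * (c 2)\<^sup>2 - 1 / 12)"
  shows "consistency_order TYPE('a::euclidean_space) M \<omega> 4"
  unfolding consistency_order_def
proof (intro allI impI, elim conjE)
  fix f :: "'a \<Rightarrow> 'a" and U y x0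
  assume U: "open U" and f: "C_on 4 f U" and sol: "local_solution f U y x0"
  have "y x0 \<in> U" using sol by (force simp: local_solution_def)
  then obtain r where r: "r > 0" "cball (y x0) r \<subseteq> U" using U open_contains_cball by blast
  let ?g = "second_deriv_field f"
  \<comment> \<open>\<open>G1\<close> and \<open>G2\<close> are the third and fourth derivatives of
    the solution at \<open>x0\<close>; \<open>?g (y x0)\<close> is the second.\<close>
  define G1 where "G1 = (lie_derivative f ^^ 2) f (y x0)"
  define G2 where "G2 = (lie_derivative f ^^ 3) f (y x0)"
  have "C_on 3 ?g U"
    using C_on_lie_derivative_funpow[OF U f, of 1]
    by (simp del: C_on.simps add: second_deriv_field_eq_lie_derivative)
  then have "C_on 1 ?g U" by (rule C_on_mono) simp
  from this r(2) obtain L where lip: "\<And>x z. x \<in> cball (y x0) r \<Longrightarrow> z \<in> cball (y x0) r \<Longrightarrow>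
      norm (?g x - ?g z) \<le> L * norm (x - z)"
    by (rule C_on_1_lipschitz_cball) blast
  have x0s: "vanishes_to 0 (x 1)" "vanishes_to 0 (x 2)"
    using vanishes_to_add[OF vanishes_to_mono[OF x1, of 0] vanishes_to_const[of "c 1"]]
      vanishes_to_add[OF vanishes_to_mono[OF x2, of 0] vanishes_to_const[of "c 2"]] by simp_all
  have unique: "\<forall>\<^sub>F h in at 0. \<exists>!Y. Y \<in> {1..2} \<rightarrow>\<^sub>E ball (y x0) r \<and> stage_equations M \<omega> f (y x0) h Y"
    by (rule stages_exist_unique[OF r(1) lip a11[unfolded a_def] a21[unfolded a_def] a22[unfolded a_def]
          x0s[unfolded x_def]])
  have "(\<lambda>h. norm (y (x0 + h) - tddirk_step M \<omega> f (y x0) h (Y h))) \<in> O[at 0](\<lambda>h. h ^ (4 + 1))"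
    if Y: "\<forall>\<^sub>F h in at 0. Y h \<in> {1..2} \<rightarrow>\<^sub>E ball (y x0) r \<and> stage_equations M \<omega> f (y x0) h (Y h)" for Y
  proof -
    note Taylor = local_solution_Taylor[OF U f sol]
    have y_exp: "vanishes_to 5 (\<lambda>h. y (x0 + h) - (y x0 + h *\<^sub>R f (y x0) + (h\<^sup>2 / 2) *\<^sub>R ?g (y x0)
        + (h ^ 3 / 6) *\<^sub>R G1 + (h ^ 4 / 24) *\<^sub>R G2))"
      using Taylor[of 0 5 1]
      by (simp add: eval_nat_numeral G1_def G2_def second_deriv_field_eq_lie_derivative algebra_simps)
    have node_exp: "vanishes_to 3 (\<lambda>h. y (x0 + k * h) - (y x0 + (k * h) *\<^sub>R f (y x0) + (k\<^sup>2 * h\<^sup>2 / 2) *\<^sub>R ?g (y x0)))" for k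
      using Taylor[of 0 3 k]
      by (simp add: eval_nat_numeral second_deriv_field_eq_lie_derivative algebra_simps)
    have g_exp: "vanishes_to 3 (\<lambda>h. ?g (y (x0 + k * h)) - (?g (y x0) + (k * h) *\<^sub>R G1 + (k\<^sup>2 * h\<^sup>2 / 2) *\<^sub>R G2))" for k
      using Taylor[of 2 3 k]
      by (simp add: eval_nat_numeral G1_def G2_def second_deriv_field_eq_lie_derivative algebra_simps)
    have in_ball: "\<forall>\<^sub>F h in at 0. Y h 1 \<in> ball (y x0) r" "\<forall>\<^sub>F h in at 0. Y h 2 \<in> ball (y x0) r"
      using Y by (auto elim!: eventually_mono simp: PiE_def Pi_def)
    \<comment> \<open>The zero term puts the first stage into the shape of
      \<open>stage_expansion\<close>, with the constant \<open>y x0\<close> as its earlier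
      stage.\<close>
    have eq1: "\<forall>\<^sub>F h in at 0. Y h 1 = y x0 + (x 1 h * h) *\<^sub>R f (y x0)
        + h\<^sup>2 *\<^sub>R (0 *\<^sub>R ?g (y x0) + a 1 1 h *\<^sub>R ?g (Y h 1))"
      using Y unfolding stage_equations_iff by eventually_elim (simp add: x_def a_def)
    have eq2: "\<forall>\<^sub>F h in at 0. Y h 2 = y x0 + (x 2 h * h) *\<^sub>R f (y x0)
        + h\<^sup>2 *\<^sub>R (a 2 1 h *\<^sub>R ?g (Y h 1) + a 2 2 h *\<^sub>R ?g (Y h 2))"
      using Y unfolding stage_equations_iff
      by eventually_elim (auto simp: x_def a_def scaleR_right_distrib add.assoc)
    have Y1: "vanishes_to 1 (\<lambda>h. Y h 1 - y x0)"
      "vanishes_to 3 (\<lambda>h. Y h 1 - (y x0 + (c 1 * h) *\<^sub>R f (y x0) + ((c 1)\<^sup>2 * h\<^sup>2 / 2) *\<^sub>R ?g (y x0)))"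
      using r(1) a1 vanishes_to_const[of "0 :: 'a"] vanishes_to_mono
      by (intro stage_expansion[OF r(1) lip in_ball(1) _ _ eq1 vanishes_to_const a11 x1];
          simp add: vanishes_to_def)+
    have Y2: "vanishes_to 3 (\<lambda>h. Y h 2 - (y x0 + (c 2 * h) *\<^sub>R f (y x0) + ((c 2)\<^sup>2 * h\<^sup>2 / 2) *\<^sub>R ?g (y x0)))"
      by (rule stage_expansion(2)[OF r(1) lip in_ball(2) in_ball(1) Y1(1) eq2 a21 a22 x2 a2])
    have y_in_ball: "\<forall>\<^sub>F h in at 0. y (x0 + k * h) \<in> ball (y x0) r" for k
    proof -
      have "isCont y x0"
      proof (rule has_vector_derivative_continuous)
        show "(y has_vector_derivative f (y x0)) (at x0)"
          using sol by (auto simp: local_solution_def)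
      qed
      then have "isCont (\<lambda>h. y (x0 + k * h)) 0"
        by (intro isCont_o2[of 0 "\<lambda>h. x0 + k * h" y]) auto
      then have "((\<lambda>h. y (x0 + k * h)) \<longlongrightarrow> y x0) (at 0)" by (simp add: isCont_def)
      from tendstoD[OF this r(1)] show ?thesis by (simp add: dist_commute)
    qed
    \<comment> \<open>The stage is compared with the exact solution at node \<open>k\<close>: both
      have the same expansion up to O(h^3), so the Lipschitz bound carries the known expansion of
      \<open>?g\<close> along the solution over to the stage.\<close>
    have g_Y: "vanishes_to 3 (\<lambda>h. ?g (u h) - (?g (y x0) + (k * h) *\<^sub>R G1 + (k\<^sup>2 * h\<^sup>2 / 2) *\<^sub>R G2))"
      if u: "\<forall>\<^sub>F h in at 0. u h \<in> ball (y x0) r"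
        and u3: "vanishes_to 3 (\<lambda>h. u h - (y x0 + (k * h) *\<^sub>R f (y x0) + (k\<^sup>2 * h\<^sup>2 / 2) *\<^sub>R ?g (y x0)))" for u k
    proof -
      have "vanishes_to 3 (\<lambda>h. u h - y (x0 + k * h))"
        using vanishes_to_diff[OF u3 node_exp[of k]] by simp
      moreover have "\<forall>\<^sub>F h in at 0. norm (?g (u h) - ?g (y (x0 + k * h))) \<le> L * norm (u h - y (x0 + k * h))"
        using u y_in_ball[of k] by eventually_elim (use lip ball_subset_cball in blast)
      ultimately have "vanishes_to 3 (\<lambda>h. ?g (u h) - ?g (y (x0 + k * h)))"
        by (rule vanishes_to_lipschitz)
      from vanishes_to_add[OF this g_exp[of k]] show ?thesis by (simp only: add_diff_eq diff_add_cancel)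
    qed
    define q where "q i h = ?g (Y h i) - (?g (y x0) + (c i * h) *\<^sub>R G1 + ((c i)\<^sup>2 * h\<^sup>2 / 2) *\<^sub>R G2)" for i h
    have q: "vanishes_to 3 (q 1)" "vanishes_to 3 (q 2)"
      unfolding q_def by (rule g_Y[OF in_ball(1) Y1(2)], rule g_Y[OF in_ball(2) Y2])
    \<comment> \<open>\<open>h^2\<close> times \<open>e\<close> is the numerical step minus the
      Taylor polynomial of degree 4; the product of 1/12 and 1/2 is the coefficient 1/24 of
      \<open>G2\<close>.\<close>
    define e where "e h = b 1 h *\<^sub>R q 1 h + b 2 h *\<^sub>R q 2 h + (b 1 h + b 2 h - 1 / 2) *\<^sub>R ?g (y x0)
      + (h * (b 1 h * c 1 + b 2 h * c 2 - 1 / 6)) *\<^sub>R G1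
      + (h\<^sup>2 * (b 1 h * (c 1)\<^sup>2 + b 2 h * (c 2)\<^sup>2 - 1 / 12)) *\<^sub>R (1 / 2) *\<^sub>R G2" for h
    have "vanishes_to 3 e"
      unfolding e_def
      using vanishes_to_scaleR[OF b0 vanishes_to_const[of "?g (y x0)"]]
        vanishes_to_scaleR[OF vanishes_to_mult[OF vanishes_to_power[of 1] b1] vanishes_to_const[of G1]]
        vanishes_to_scaleR[OF vanishes_to_mult[OF vanishes_to_power[of 2] b2] vanishes_to_const[of "(1 / 2) *\<^sub>R G2"]]
      by (intro vanishes_to_add vanishes_to_bounded_scaleR[OF b(1) q(1)] vanishes_to_bounded_scaleR[OF b(2) q(2)])
        (simp_all add: eval_nat_numeral)
    then have "vanishes_to 5 (\<lambda>h. h\<^sup>2 *\<^sub>R e h)"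
      using vanishes_to_scaleR[OF vanishes_to_power[of 2], of 3 e] by simp
    from vanishes_to_diff[OF y_exp this]
    have "vanishes_to 5 (\<lambda>h. y (x0 + h) - (y x0 + h *\<^sub>R f (y x0) + (h\<^sup>2 / 2) *\<^sub>R ?g (y x0)
        + (h ^ 3 / 6) *\<^sub>R G1 + (h ^ 4 / 24) *\<^sub>R G2) - h\<^sup>2 *\<^sub>R e h)" .
    also have "(\<lambda>h. y (x0 + h) - (y x0 + h *\<^sub>R f (y x0) + (h\<^sup>2 / 2) *\<^sub>R ?g (y x0)
        + (h ^ 3 / 6) *\<^sub>R G1 + (h ^ 4 / 24) *\<^sub>R G2) - h\<^sup>2 *\<^sub>R e h)
      = (\<lambda>h. y (x0 + h) - tddirk_step M \<omega> f (y x0) h (Y h))"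
    proof
      fix h
      have I: "{1..2::nat} = {1, 2}" by auto
      have step: "tddirk_step M \<omega> f (y x0) h (Y h) = y x0 + h *\<^sub>R f (y x0)
          + h\<^sup>2 *\<^sub>R (b 1 h *\<^sub>R ?g (Y h 1) + b 2 h *\<^sub>R ?g (Y h 2))"
        unfolding tddirk_step_def I by (simp add: b_def)
      show "y (x0 + h) - (y x0 + h *\<^sub>R f (y x0) + (h\<^sup>2 / 2) *\<^sub>R ?g (y x0)
        + (h ^ 3 / 6) *\<^sub>R G1 + (h ^ 4 / 24) *\<^sub>R G2) - h\<^sup>2 *\<^sub>R e h
        = y (x0 + h) - tddirk_step M \<omega> f (y x0) h (Y h)"
        unfolding step e_def q_def
        by (rule euclidean_eqI) (simp add: inner_simps field_simps eval_nat_numeral)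
    qed
    finally show ?thesis by (simp add: vanishes_to_def)
  qed
  with r unique show "\<exists>r>0. ball (y x0) r \<subseteq> U
         \<and> (\<forall>\<^sub>F h in at 0. \<exists>!Y. Y \<in> {1..2} \<rightarrow>\<^sub>E ball (y x0) r \<and> stage_equations M \<omega> f (y x0) h Y)
         \<and> (\<forall>Y. (\<forall>\<^sub>F h in at 0. Y h \<in> {1..2} \<rightarrow>\<^sub>E ball (y x0) r
                                  \<and> stage_equations M \<omega> f (y x0) h (Y h)) \<longrightarrow>
              (\<lambda>h. norm (y (x0 + h) - tddirk_step M \<omega> f (y x0) h (Y h)))
                \<in> O[at 0](\<lambda>h. h ^ (4 + 1)))"
    by (intro exI[of _ r] conjI allI impI) (auto dest: ball_subset_cball[THEN subsetD])
qed

theorem mainTheorem4: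
  fixes c1 c2 \<phi> \<omega> :: real
  assumes "c1 \<noteq> c2" and "c2 \<noteq> 0"
    and "2 * (c1 + c2 - 3 * c1 * c2) - 1 = 0"
    and "\<omega> > 0"
  shows "(\<forall>h. ef_admissible c1 c2 (mu \<omega> h) \<longrightarrow> fitting_conditions (ef_tddirk c1 c2 \<phi>) (mu \<omega> h))
    \<and> consistency_order TYPE('a::euclidean_space) (ef_tddirk c1 c2 \<phi>) \<omega> 4"
proof
  let ?M = "ef_tddirk c1 c2 \<phi>"
  show fitting: "\<forall>h. ef_admissible c1 c2 (mu \<omega> h) \<longrightarrow> fitting_conditions ?M (mu \<omega> h)"
    using ef_tddirk_fitting_conditions assms(2) by blast
  \<comment> \<open>The fitting conditions are available at admissible points, and these include all
    small \<open>h\<close>; the real equations therefore hold eventually.\<close>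
  have "\<forall>\<^sub>F h in at 0. ef_admissible c1 c2 (mu \<omega> h)"
    using at_within_le_nhds ef_admissible_small[OF assms(1)] by (rule filter_leD)
  then have ev: "\<forall>\<^sub>F h in at 0. fitting_conditions ?M (mu \<omega> h)"
    by eventually_elim (use fitting in blast)
  have M: "cnode ?M 1 = c1" "cnode ?M 2 = c2" "acoef ?M 2 1 = (\<lambda>_. complex_of_real \<phi>)"
    by (simp_all add: ef_tddirk_def)
  note real_form = fitting_conditions_real_form[of ?M \<omega>, unfolded M Re_complex_of_real]
  define a1 where "a1 h = Re (acoef ?M 1 1 (mu \<omega> h))" for h
  define a2 where "a2 h = Re (acoef ?M 2 2 (mu \<omega> h))" for h
  define x1 where "x1 h = Re (xicoef ?M 1 (mu \<omega> h)) * c1" for h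
  define x2 where "x2 h = Re (xicoef ?M 2 (mu \<omega> h)) * c2" for h
  define b1 where "b1 h = Re (bcoef ?M 1 (mu \<omega> h))" for h
  define b2 where "b2 h = Re (bcoef ?M 2 (mu \<omega> h))" for h
  note defs = a1_def a2_def x1_def x2_def b1_def b2_def
  note real_form' = real_form[folded defs]
  \<comment> \<open>The zero terms present the first stage as the case \<open>\<phi> = 0\<close> of
    the general stage equations.\<close>
  have stage1: "\<forall>\<^sub>F h in at 0. (\<omega> * h)\<^sup>2 * (0 * cos (c1 * \<omega> * h) + a1 h * cos (c1 * \<omega> * h)) = 1 - cos (c1 * \<omega> * h)"
    "\<forall>\<^sub>F h in at 0. x1 h * (\<omega> * h) - (\<omega> * h)\<^sup>2 * (0 * sin (c1 * \<omega> * h) + a1 h * sin (c1 * \<omega> * h)) = sin (c1 * \<omega> * h)"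
    using ev by (eventually_elim, simp add: real_form')+
  have stage2: "\<forall>\<^sub>F h in at 0. (\<omega> * h)\<^sup>2 * (\<phi> * cos (c1 * \<omega> * h) + a2 h * cos (c2 * \<omega> * h)) = 1 - cos (c2 * \<omega> * h)"
    "\<forall>\<^sub>F h in at 0. x2 h * (\<omega> * h) - (\<omega> * h)\<^sup>2 * (\<phi> * sin (c1 * \<omega> * h) + a2 h * sin (c2 * \<omega> * h)) = sin (c2 * \<omega> * h)"
    using ev by (eventually_elim, simp add: real_form')+
  have quadrature: "\<forall>\<^sub>F h in at 0. (\<omega> * h)\<^sup>2 * (b1 h * cos (c1 * \<omega> * h) + b2 h * cos (c2 * \<omega> * h)) = 1 - cos (\<omega> * h)"
    "\<forall>\<^sub>F h in at 0. (\<omega> * h)\<^sup>2 * (b1 h * sin (c1 * \<omega> * h) + b2 h * sin (c2 * \<omega> * h)) = \<omega> * h - sin (\<omega> * h)"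
    using ev by (eventually_elim, simp add: real_form')+
  note s1 = stage_coefficients_asymptotics[OF assms(4) stage1]
  note s2 = stage_coefficients_asymptotics[OF assms(4) stage2]
  note w = quadrature_weights_asymptotics[OF assms(4,1,3) quadrature]
  show "consistency_order TYPE('a) ?M \<omega> 4"
    \<comment> \<open>The rates 2 and 4 obtained for the coefficient sums are lowered to the 1 and 3
      of the criterion.\<close>
    by (rule consistency_order_4I; unfold M Re_complex_of_real defs[symmetric])
      (use s1 s2 w vanishes_to_const[of \<phi>] vanishes_to_mono[OF s1(2), of 1]
        vanishes_to_mono[OF s2(2), of 1] vanishes_to_mono[OF w(3), of 3]
        vanishes_to_mono[OF w(5), of 1] in simp_all)
qed

end
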